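(* For any matroid $M=([n],\mathcal{I})$, the polynomial \[ g_M(y,z_1,\dots,z_n)=\sum_{I\in\mathcal{I}} y^{n-|I|}\prod_{i\in I} z_i \in\mathbb{R}[y,z_1,\dots,z_n] \] is completely log-concave.
   Context: A matroid $M=([n],\mathcal{I})$ consists of a ground set $[n]=\{1,\dots,n\}$ and a nonempty collection $\mathcal{I}$ of subsets of $[n]$ (the independent sets) such that (1) if $S\subseteq T$ and $T\in\mathcal{I}$ then $S\in\mathcal{I}$, and (2) if $S,T\in\mathcal{I}$ with $|T|>|S|$ then there is $i\in T\setminus S$ with $S\cup\{i\}\in\mathcal{I}$. For a polynomial in $m$ variables and $v\in\mathbb{R}^m$, $D_v=\sum_i v_i\partial_i$ is the directional derivative. A polynomial $f$ in $m$ variables is log-concave over $\mathbb{R}^m_{\geq 0}$ if $f(u)\geq 0$ for all $u\in\mathbb{R}^m_{\geq0}$ and $f(\lambda u+(1-\lambda)v)\geq f(u)^\lambda f(v)^{1-\lambda}$ for all $u,v\in\mathbb{R}^m_{\geq 0}$, $\lambda\in[0,1]$. It is completely log-concave if for every finite collection $v_1,\dots,v_k\in\mathbb{R}^m_{\geq 0}$ (including $k=0$), $D_{v_1}\cdots D_{v_k}f$ is nonnegative and log-concave over $\mathbb{R}^m_{\geq 0}$. *)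

theory Defs
  imports Complex_Main "HOL-Library.Poly_Mapping"
begin

text \<open>
  A polynomial over the reals is a finitely supported map from monomials to coefficients, and
  a monomial is a finitely supported map from variables to exponents. The ring structure is the
  convolution structure of \<^theory>\<open>HOL-Library.Poly_Mapping\<close>.
\<close>

type_synonym 'v real_mpoly = "('v \<Rightarrow>\<^sub>0 nat) \<Rightarrow>\<^sub>0 real"

definition const :: "real \<Rightarrow> 'v real_mpoly" where
  "const c = Poly_Mapping.single 0 c"

definition var :: "'v \<Rightarrow> 'v real_mpoly" where
  "var i = Poly_Mapping.single (Poly_Mapping.single i 1) 1"

definition vars :: "'v real_mpoly \<Rightarrow> 'v set" where
  "vars f = (\<Union>m \<in> Poly_Mapping.keys f. Poly_Mapping.keys m)"

definition evalp :: "'v real_mpoly \<Rightarrow> ('v \<Rightarrow> real) \<Rightarrow> real" where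
  "evalp f x = (\<Sum>m \<in> Poly_Mapping.keys f.
     Poly_Mapping.lookup f m * (\<Prod>i \<in> Poly_Mapping.keys m. x i ^ Poly_Mapping.lookup m i))"

text \<open>
  The subtraction of exponents is truncated, but the terms in which this matters have
  coefficient 0.
\<close>

definition partial_deriv :: "'v \<Rightarrow> 'v real_mpoly \<Rightarrow> 'v real_mpoly" where
  "partial_deriv i f = (\<Sum>m \<in> Poly_Mapping.keys f.
     Poly_Mapping.single (m - Poly_Mapping.single i 1)
       (real (Poly_Mapping.lookup m i) * Poly_Mapping.lookup f m))"

text \<open>
  For a finite set \<open>V\<close> of variables, the space of real vectors indexed by \<open>V\<close> is represented by
  the functions that vanish outside \<open>V\<close>.
\<close>

definition nonneg_orthant :: "'v set \<Rightarrow> ('v \<Rightarrow> real) set" where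
  "nonneg_orthant V = {u. (\<forall>i\<in>V. 0 \<le> u i) \<and> (\<forall>i. i \<notin> V \<longrightarrow> u i = 0)}"

definition dir_deriv :: "'v set \<Rightarrow> ('v \<Rightarrow> real) \<Rightarrow> 'v real_mpoly \<Rightarrow> 'v real_mpoly" where
  "dir_deriv V v f = (\<Sum>i\<in>V. const (v i) * partial_deriv i f)"

text \<open>
  In the library \<open>0 powr 0 = 0\<close>. This does not affect the definition: for \<open>\<lambda> = 0\<close> and \<open>\<lambda> = 1\<close> the
  inequality holds for every nonnegative \<open>f\<close> under either convention for \<open>0\<^sup>0\<close>.
\<close>

definition log_concave :: "'v set \<Rightarrow> 'v real_mpoly \<Rightarrow> bool" where
  "log_concave V f \<longleftrightarrow>
     (\<forall>u \<in> nonneg_orthant V. 0 \<le> evalp f u) \<and>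
     (\<forall>u \<in> nonneg_orthant V. \<forall>v \<in> nonneg_orthant V. \<forall>l \<in> {0..1}.
        evalp f (\<lambda>i. l * u i + (1 - l) * v i) \<ge> evalp f u powr l * evalp f v powr (1 - l))"

text \<open>
  The first conjunct says that \<open>f\<close> is a polynomial in the variables \<open>V\<close>.
  Nonnegativity of the derivatives is part of \<open>log_concave\<close>.
\<close>

definition completely_log_concave :: "'v set \<Rightarrow> 'v real_mpoly \<Rightarrow> bool" where
  "completely_log_concave V f \<longleftrightarrow>
     vars f \<subseteq> V \<and>
     (\<forall>vs. set vs \<subseteq> nonneg_orthant V \<longrightarrow> log_concave V (foldr (dir_deriv V) vs f))"

definition matroid :: "nat \<Rightarrow> nat set set \<Rightarrow> bool" where
  "matroid n \<I> \<longleftrightarrow>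
     \<I> \<subseteq> Pow {1..n} \<and> \<I> \<noteq> {} \<and>
     (\<forall>S T. S \<subseteq> T \<and> T \<in> \<I> \<longrightarrow> S \<in> \<I>) \<and>
     (\<forall>S\<in>\<I>. \<forall>T\<in>\<I>. card T > card S \<longrightarrow> (\<exists>i \<in> T - S. S \<union> {i} \<in> \<I>))"

text \<open>The variable \<open>y\<close> has index 0, and \<open>z\<^sub>i\<close> has index \<open>i\<close> for \<open>1 \<le> i \<le> n\<close>.\<close>

definition matroid_poly :: "nat \<Rightarrow> nat set set \<Rightarrow> nat real_mpoly" where
  "matroid_poly n \<I> = (\<Sum>I\<in>\<I>. var 0 ^ (n - card I) * (\<Prod>i\<in>I. var i))"

end

theory Submission
  imports Defs "HOL-Analysis.Convex" "HOL-Analysis.Function_Topology"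
begin

text \<open>
  Let \<open>f\<close> be a partial derivative of \<open>g\<^sub>M\<close>, of degree \<open>d\<close>. For positive directions \<open>w\<^sub>1, \<dots>, w\<^sub>d\<^sub>-\<^sub>2\<close> the quadratic form
  with polarization \<open>(x, z) \<mapsto> D\<^sub>x D\<^sub>z D\<^bsub>w\<^sub>1\<^esub> \<cdots> D\<^bsub>w\<^sub>d\<^sub>-\<^sub>2\<^esub> f\<close> satisfies the reverse Cauchy--Schwarz
  inequality, by induction on \<open>d\<close>: the inequalities for the partial derivatives \<open>\<partial>\<^sub>i f\<close> combine
  into \<open>P \<le> P\<^sup>2\<close> for a reversible Markov operator \<open>P\<close>, so every eigenvalue of \<open>P\<close> is nonpositive or
  at least 1, and the eigenvalue 1 is simple because every variable that occurs is adjacent to \<open>y\<close>.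
  Consequently \<open>j \<mapsto> D\<^sub>u\<^sup>j D\<^sub>x\<^sup>m\<^sup>-\<^sup>j h\<close> is a log-concave sequence for every directional derivative \<open>h\<close> of \<open>f\<close>,
  which with the inequality of the arithmetic and geometric means makes \<open>h\<close> log-concave, first for
  positive and then, by continuity, for nonnegative vectors. Partial derivatives of \<open>g\<^sub>M\<close> come from
  contractions and from differentiation in \<open>y\<close>, so only quadrics remain. For \<open>N\<close> elements these are
  multiples of \<open>N (N - 1) y\<^sup>2 + 2 (N - 1) y \<sigma> + \<sigma>\<^sup>2 - \<Sum>\<^sub>c s\<^sub>c\<^sup>2\<close>, where \<open>s\<^sub>c\<close> is the sum of the variables
  of the parallel class \<open>c\<close> and \<open>\<sigma> = \<Sum>\<^sub>c s\<^sub>c\<close>. This is \<open>(N - 1) / N * (N y + \<sigma>)\<^sup>2 + \<sigma>\<^sup>2 / N - \<Sum>\<^sub>c s\<^sub>c\<^sup>2\<close>, and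
  \<open>\<sigma>\<^sup>2 \<le> N * \<Sum>\<^sub>c s\<^sub>c\<^sup>2\<close> as there are at most \<open>N\<close> classes.
\<close>

subsection \<open>Reversible Markov operators\<close>

text \<open>Tychonoff's theorem: the set is a product of compact intervals. Vectors here are
  functions on the whole type, so compactness is taken in the product topology.\<close>

lemma compact_coordinate_box:
  fixes c :: "'v \<Rightarrow> real"
  shows "compact {x :: 'v \<Rightarrow> real. \<forall>i. \<bar>x i\<bar> \<le> c i}"
proof -
  have "compactin (product_topology (\<lambda>i. euclideanreal) UNIV) (PiE UNIV (\<lambda>i. {- c i..c i}))"
    by (simp add: compactin_PiE)
  moreover have "PiE UNIV (\<lambda>i. {- c i..c i}) = {x. \<forall>i. \<bar>x i\<bar> \<le> c i}"
    by (auto simp: PiE_def Pi_def abs_le_iff minus_le_iff)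
  ultimately show ?thesis
    by (simp add: euclidean_product_topology)
qed

text \<open>The first-order condition at a minimum: for small \<open>t\<close> of the sign opposite
  to \<open>b\<close>, the linear term would dominate.\<close>

lemma linear_coeff_zero:
  fixes b c :: real
  assumes "\<And>t. 0 \<le> 2 * t * b + t^2 * c"
  shows "b = 0"
proof (rule ccontr)
  assume "b \<noteq> 0"
  \<comment> \<open>This minimizes the quadratic after \<open>c\<close> is replaced by the larger
    and strictly positive \<open>1 + \<bar>c\<bar>\<close>.\<close>
  define s where "s = - b / (1 + \<bar>c\<bar>)"
  have "2 * s * b + s^2 * c \<le> 2 * s * b + s^2 * (1 + \<bar>c\<bar>)"
    by (intro add_left_mono mult_left_mono) auto
  also have "\<dots> = - (b^2 / (1 + \<bar>c\<bar>))"
  proof -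
    have "1 + \<bar>c\<bar> \<noteq> 0" by linarith
    then show ?thesis by (simp add: s_def power_divide power2_eq_square divide_simps)
  qed
  also have "\<dots> < 0"
    using \<open>b \<noteq> 0\<close> by simp
  finally show False
    using assms[of s] by simp
qed

lemma quadratic_form_add:
  fixes p :: "'v \<Rightarrow> 'v \<Rightarrow> real"
  assumes "finite V" and sym: "\<And>i j. p i j = p j i"
  shows "(\<Sum>i\<in>V. \<Sum>j\<in>V. p i j * (x i + t * y i) * (x j + t * y j)) =
    (\<Sum>i\<in>V. \<Sum>j\<in>V. p i j * x i * x j) + 2 * t * (\<Sum>i\<in>V. \<Sum>j\<in>V. p i j * y i * x j)
      + t^2 * (\<Sum>i\<in>V. \<Sum>j\<in>V. p i j * y i * y j)"
proof -
  have "(\<Sum>i\<in>V. \<Sum>j\<in>V. p i j * x i * y j) = (\<Sum>j\<in>V. \<Sum>i\<in>V. p i j * x i * y j)"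
    by (rule sum.swap)
  also have "\<dots> = (\<Sum>i\<in>V. \<Sum>j\<in>V. p i j * y i * x j)"
    by (intro sum.cong refl) (simp add: sym mult_ac)
  finally have *: "(\<Sum>i\<in>V. \<Sum>j\<in>V. p i j * x i * y j) = (\<Sum>i\<in>V. \<Sum>j\<in>V. p i j * y i * x j)" .
  have "(\<Sum>i\<in>V. \<Sum>j\<in>V. p i j * (x i + t * y i) * (x j + t * y j)) =
    (\<Sum>i\<in>V. \<Sum>j\<in>V. p i j * x i * x j) + t * (\<Sum>i\<in>V. \<Sum>j\<in>V. p i j * x i * y j)
     + t * (\<Sum>i\<in>V. \<Sum>j\<in>V. p i j * y i * x j)
      + t^2 * (\<Sum>i\<in>V. \<Sum>j\<in>V. p i j * y i * y j)"
    by (simp add: sum_distrib_left algebra_simps power2_eq_square flip: sum.distrib)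
  then show ?thesis
    unfolding * by simp
qed

text \<open>The walk with transition probabilities \<open>p i j / r i\<close> is self-adjoint for
  the inner product with weights \<open>r\<close>, and \<open>square\<close> says that its operator
  is at most its own square. A maximizer of the quadratic form on the unit sphere orthogonal to the
  constants is an eigenvector. If its eigenvalue were positive, it would be at least 1, and the
  eigenvector would be constant, against orthogonality.\<close>

lemma reversible_walk_spectral_gap:
  fixes p :: "'v \<Rightarrow> 'v \<Rightarrow> real"
  assumes fin: "finite V" and sym: "\<And>i j. p i j = p j i"
    and nonneg: "\<And>i j. i \<in> V \<Longrightarrow> j \<in> V \<Longrightarrow> 0 \<le> p i j"
    and r_def: "\<And>i. r i = (\<Sum>j\<in>V. p i j)"
    and pos: "\<And>i. i \<in> V \<Longrightarrow> 0 < r i"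
    and star: "\<And>i. i \<in> V \<Longrightarrow> i \<noteq> hub \<Longrightarrow> 0 < p hub i" and "hub \<in> V"
    and square: "\<And>x. (\<Sum>i\<in>V. \<Sum>j\<in>V. p i j * x i * x j) \<le> (\<Sum>i\<in>V. (\<Sum>j\<in>V. p i j * x j)^2 / r i)"
    and orth: "(\<Sum>i\<in>V. r i * x i) = 0"
  shows "(\<Sum>i\<in>V. \<Sum>j\<in>V. p i j * x i * x j) \<le> 0"
proof (rule ccontr)
  define P where "P x y = (\<Sum>i\<in>V. \<Sum>j\<in>V. p i j * x i * y j)" for x y
  define R where "R x y = (\<Sum>i\<in>V. r i * x i * y i)" for x y :: "'v \<Rightarrow> real"
  \<comment> \<open>The unit sphere of the complement of the constants. On \<open>V\<close> the
    coordinate bounds follow from \<open>R x x = 1\<close>; with the value 0 outside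
    \<open>V\<close> they place \<open>K\<close> in a compact box.\<close>
  define K where "K = {x. (\<forall>i. \<bar>x i\<bar> \<le> (if i \<in> V then 1 / sqrt (r i) else 0)) \<and> R x x = 1 \<and>
    (\<Sum>i\<in>V. r i * x i) = 0}"
  assume "\<not> (\<Sum>i\<in>V. \<Sum>j\<in>V. p i j * x i * x j) \<le> 0"
  then have Px: "P x x > 0" by (simp add: P_def)
  have Psym: "P x y = P y x" for x y
    unfolding P_def by (subst sum.swap) (intro sum.cong refl, simp add: sym mult_ac)
  have R_nonneg: "R y y \<ge> 0" for y
    unfolding R_def by (intro sum_nonneg) (simp add: mult.assoc pos less_imp_le)
  have R_zero: "y i = 0" if "R y y = 0" "i \<in> V" for y i
  proof -
    have "\<forall>i\<in>V. r i * y i * y i = 0"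
      using that(1) unfolding R_def by (subst sum_nonneg_eq_0_iff[symmetric])
        (auto simp: fin mult.assoc pos less_imp_le)
    with pos[OF that(2)] that(2) show ?thesis by force
  qed
  have normalize: "\<exists>z\<in>K. P y y = R y y * P z z" if orth: "(\<Sum>i\<in>V. r i * y i) = 0" and nz: "R y y > 0" for y
  proof -
    define s where "s = sqrt (R y y)"
    have s: "s > 0" "s^2 = R y y" using nz by (auto simp: s_def)
    define z where "z i = (if i \<in> V then y i / s else 0)" for i
    have Rz: "R z z = 1"
    proof -
      have "R z z = R y y / s^2"
        unfolding R_def z_def sum_divide_distrib
        by (intro sum.cong refl) (simp add: power2_eq_square)
      then show ?thesis using s by auto
    qed
    have "\<bar>z i\<bar> \<le> (if i \<in> V then 1 / sqrt (r i) else 0)" for i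
    proof (cases "i \<in> V")
      case True
      have "r i * z i * z i \<le> R z z"
        unfolding R_def by (rule member_le_sum[OF True]) (auto simp: fin mult.assoc pos less_imp_le)
      then have "r i * (z i)^2 \<le> 1" by (simp add: Rz power2_eq_square mult_ac)
      then have "(z i)^2 \<le> 1 / r i" using pos[OF True] by (simp add: field_simps)
      then have "sqrt ((z i)^2) \<le> sqrt (1 / r i)" by (rule real_sqrt_le_mono)
      then show ?thesis using True by (simp add: real_sqrt_divide)
    qed (simp add: z_def)
    moreover have "(\<Sum>i\<in>V. r i * z i) = 0"
    proof -
      have "(\<Sum>i\<in>V. r i * z i) = (\<Sum>i\<in>V. r i * y i) / s"
        unfolding z_def sum_divide_distrib by (intro sum.cong refl) auto
      then show ?thesis by (simp add: orth)
    qed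
    ultimately have "z \<in> K" by (simp add: K_def Rz)
    moreover have "P z z = P y y / s^2"
      unfolding P_def z_def sum_divide_distrib by (intro sum.cong refl) (auto simp: power2_eq_square)
    ultimately show ?thesis using s nz by (intro bexI[of _ z]) auto
  qed
  have "R x x \<noteq> 0"
  proof
    assume "R x x = 0"
    then have "P x x = 0" unfolding P_def by (intro sum.neutral ballI) (auto dest: R_zero)
    with Px show False by simp
  qed
  then have "R x x > 0" using R_nonneg[of x] by simp
  with normalize[OF orth] obtain z0 where z0: "z0 \<in> K" "P x x = R x x * P z0 z0" by blast
  have Pz0: "P z0 z0 > 0" using z0 Px \<open>R x x > 0\<close> by (simp add: zero_less_mult_iff)
  have "compact K"
  proof -
    have cont: "continuous_on UNIV (\<lambda>x :: 'v \<Rightarrow> real. x i)" for i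
      by (rule continuous_on_product_coordinates)
    have "closed {x. R x x = 1}" "closed {x :: 'v \<Rightarrow> real. (\<Sum>i\<in>V. r i * x i) = 0}"
      unfolding R_def by (intro closed_Collect_eq continuous_intros cont)+
    then have "compact ({x. \<forall>i. \<bar>x i\<bar> \<le> (if i \<in> V then 1 / sqrt (r i) else 0)} \<inter>
        ({x. R x x = 1} \<inter> {x. (\<Sum>i\<in>V. r i * x i) = 0}))"
      by (intro compact_Int_closed compact_coordinate_box closed_Int)
    also have "\<dots> = K" by (auto simp: K_def)
    finally show ?thesis .
  qed
  moreover have "continuous_on K (\<lambda>x. P x x)"
    unfolding P_def
    by (intro continuous_intros continuous_on_subset[OF continuous_on_product_coordinates subset_UNIV])
  moreover have "K \<noteq> {}" using z0 by auto
  ultimately obtain z where z: "z \<in> K" and max: "\<And>y. y \<in> K \<Longrightarrow> P y y \<le> P z z"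
    using continuous_attains_sup[of K "\<lambda>x. P x x"] by blast
  define m where "m = P z z"
  have m: "m > 0" using max[OF z0(1)] Pz0 by (simp add: m_def)
  have Rz: "R z z = 1" and orthz: "(\<Sum>i\<in>V. r i * z i) = 0" using z by (auto simp: K_def)
  \<comment> \<open>Both sides are homogeneous of degree 2, so the maximum over the unit sphere
    bounds the form on the whole complement.\<close>
  have le: "P y y \<le> m * R y y" if "(\<Sum>i\<in>V. r i * y i) = 0" for y
  proof (cases "R y y = 0")
    case True
    then have "P y y = 0" unfolding P_def by (intro sum.neutral ballI) (auto dest: R_zero)
    then show ?thesis using True by simp
  next
    case False
    then have "R y y > 0" using R_nonneg[of y] by simp
    with normalize[OF that] obtain w where "w \<in> K" "P y y = R y y * P w w" by blast
    then show ?thesis using max[of w] R_nonneg[of y] by (simp add: m_def mult.commute mult_right_mono)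
  qed
  \<comment> \<open>Along the line \<open>z + t * y\<close> the difference \<open>m * R - P\<close>
    is nonnegative and vanishes at \<open>t = 0\<close>, so its linear term is 0.\<close>
  have eigen_orth: "P y z = m * R y z" if "(\<Sum>i\<in>V. r i * y i) = 0" for y
  proof -
    have Padd: "P (\<lambda>i. z i + t * y i) (\<lambda>i. z i + t * y i) = m + 2 * t * P y z + t^2 * P y y" for t
      unfolding P_def m_def by (rule quadratic_form_add[OF fin sym])
    have Radd: "R (\<lambda>i. z i + t * y i) (\<lambda>i. z i + t * y i) = 1 + 2 * t * R y z + t^2 * R y y" for t
      unfolding Rz[symmetric] R_def
      by (simp add: sum_distrib_left algebra_simps power2_eq_square flip: sum.distrib)
    have "0 \<le> 2 * t * (m * R y z - P y z) + t^2 * (m * R y y - P y y)" for t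
    proof -
      have "(\<Sum>i\<in>V. r i * (z i + t * y i)) = (\<Sum>i\<in>V. r i * z i) + t * (\<Sum>i\<in>V. r i * y i)"
        by (simp add: sum_distrib_left algebra_simps flip: sum.distrib)
      then have "P (\<lambda>i. z i + t * y i) (\<lambda>i. z i + t * y i) \<le> m * R (\<lambda>i. z i + t * y i) (\<lambda>i. z i + t * y i)"
        by (intro le) (simp add: that orthz)
      then show ?thesis unfolding Padd Radd by (simp add: algebra_simps)
    qed
    then have "m * R y z - P y z = 0" by (rule linear_coeff_zero)
    then show ?thesis by simp
  qed
  have P1: "P (\<lambda>_. 1) y = (\<Sum>i\<in>V. r i * y i)" for y
    unfolding Psym[of "\<lambda>_. 1"] unfolding P_def r_def by (simp add: sum_distrib_left mult.commute)
  \<comment> \<open>Subtracting the weighted mean \<open>c\<close> makes \<open>y\<close> orthogonal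
    to the constants; on constants both sides vanish because \<open>z\<close> is orthogonal to
    them.\<close>
  have eigen: "P y z = m * R y z" for y
  proof -
    define c where "c = (\<Sum>i\<in>V. r i * y i) / (\<Sum>i\<in>V. r i)"
    have "(\<Sum>i\<in>V. r i) > 0" using fin pos \<open>hub \<in> V\<close> by (intro sum_pos) auto
    then have "(\<Sum>i\<in>V. r i) * c = (\<Sum>i\<in>V. r i * y i)" by (simp add: c_def)
    then have "(\<Sum>i\<in>V. r i * (y i - c)) = 0"
      by (simp add: right_diff_distrib sum_subtractf flip: sum_distrib_right)
    then have "P (\<lambda>i. y i - c) z = m * R (\<lambda>i. y i - c) z" by (rule eigen_orth)
    moreover have "P (\<lambda>i. y i - c) z = P y z - c * P (\<lambda>_. 1) z"
      unfolding P_def by (simp add: algebra_simps sum_distrib_left sum_subtractf)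
    moreover have "R (\<lambda>i. y i - c) z = R y z - c * (\<Sum>i\<in>V. r i * z i)"
      unfolding R_def by (simp add: algebra_simps sum_distrib_left sum_subtractf)
    ultimately show ?thesis by (simp add: P1 orthz)
  qed
  \<comment> \<open>Testing \<open>eigen\<close> against a coordinate vector gives the eigenvalue
    equation pointwise.\<close>
  have row: "(\<Sum>j\<in>V. p i j * z j) = m * (r i * z i)" if "i \<in> V" for i
  proof -
    define e :: "'v \<Rightarrow> real" where "e k = (if k = i then 1 else 0)" for k
    have "P e z = (\<Sum>k\<in>V. if k = i then \<Sum>j\<in>V. p i j * z j else 0)"
      unfolding P_def e_def by (intro sum.cong refl) auto
    moreover have "R e z = (\<Sum>k\<in>V. if k = i then r i * z i else 0)"
      unfolding R_def e_def by (intro sum.cong refl) auto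
    ultimately show ?thesis using eigen[of e] that fin by simp
  qed
  have "m \<le> m^2"
  proof -
    have "m \<le> (\<Sum>i\<in>V. (\<Sum>j\<in>V. p i j * z j)^2 / r i)"
      using square[of z] by (simp add: m_def P_def)
    also have "\<dots> = (\<Sum>i\<in>V. m^2 * (r i * z i * z i))"
      using pos by (intro sum.cong refl) (simp add: row power2_eq_square less_imp_neq[THEN not_sym])
    also have "\<dots> = m^2 * R z z" by (simp add: R_def sum_distrib_left)
    finally show ?thesis by (simp add: Rz)
  qed
  then have "m \<ge> 1" using m by (simp add: power2_eq_square)
  \<comment> \<open>The Dirichlet form of the walk: it is nonnegative, but equals
    \<open>2 - 2 * m\<close>, so every term vanishes.\<close>
  have "(\<Sum>i\<in>V. \<Sum>j\<in>V. p i j * (z i - z j)^2) = 2 * R z z - 2 * P z z"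
  proof -
    have "(\<Sum>i\<in>V. \<Sum>j\<in>V. p i j * (z i - z j)^2) =
      (\<Sum>i\<in>V. \<Sum>j\<in>V. p i j * (z i)^2) + (\<Sum>i\<in>V. \<Sum>j\<in>V. p i j * (z j)^2) - 2 * P z z"
      unfolding P_def
      by (simp add: power2_eq_square algebra_simps sum.distrib sum_subtractf sum_distrib_left)
    moreover have "(\<Sum>i\<in>V. \<Sum>j\<in>V. p i j * (z j)^2) = (\<Sum>i\<in>V. \<Sum>j\<in>V. p i j * (z i)^2)"
      by (subst sum.swap) (simp add: sym)
    moreover have "(\<Sum>i\<in>V. \<Sum>j\<in>V. p i j * (z i)^2) = R z z"
      unfolding R_def r_def by (simp add: sum_distrib_right power2_eq_square mult.assoc)
    ultimately show ?thesis by simp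
  qed
  also have "\<dots> \<le> 0" using \<open>m \<ge> 1\<close> by (simp add: Rz m_def)
  finally have "(\<Sum>i\<in>V. \<Sum>j\<in>V. p i j * (z i - z j)^2) = 0"
    by (intro antisym sum_nonneg mult_nonneg_nonneg nonneg) auto
  then have "\<forall>i\<in>V. (\<Sum>j\<in>V. p i j * (z i - z j)^2) = 0"
    by (subst sum_nonneg_eq_0_iff[symmetric]) (auto intro!: fin sum_nonneg mult_nonneg_nonneg nonneg)
  then have "(\<Sum>j\<in>V. p hub j * (z hub - z j)^2) = 0" using \<open>hub \<in> V\<close> by blast
  then have "\<forall>j\<in>V. p hub j * (z hub - z j)^2 = 0"
    by (subst sum_nonneg_eq_0_iff[symmetric]) (auto intro!: fin mult_nonneg_nonneg nonneg \<open>hub \<in> V\<close>)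
  \<comment> \<open>The hub has positive weight to every other vertex, which gives connectedness in
    one step.\<close>
  then have const: "z j = z hub" if "j \<in> V" for j
    using star[of j] that by (cases "j = hub") auto
  have "R z z = (\<Sum>i\<in>V. r i * z i) * z hub"
    unfolding R_def sum_distrib_right by (intro sum.cong refl) (simp add: const)
  then show False by (simp add: orthz Rz)
qed

subsection \<open>Derivatives and evaluation of polynomials\<close>

lemma lookup_const_mult [simp]:
  "Poly_Mapping.lookup (const c * f) m = c * Poly_Mapping.lookup f m"
  unfolding const_def by (simp flip: mult_map_scale_conv_mult add: Poly_Mapping.map.rep_eq when_def)

lemma const_add: "const (a + b) = const a + const b"
  by (simp add: const_def single_add)

lemma const_mult: "const (a * b) = const a * const b"
  by (simp add: const_def mult_single)

lemma partial_deriv_superset: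
  assumes "finite S" "Poly_Mapping.keys f \<subseteq> S"
  shows "partial_deriv i f = (\<Sum>m\<in>S. Poly_Mapping.single (m - Poly_Mapping.single i 1)
       (real (Poly_Mapping.lookup m i) * Poly_Mapping.lookup f m))"
  unfolding partial_deriv_def
  by (rule sum.mono_neutral_left) (use assms in \<open>auto simp: in_keys_iff\<close>)

text \<open>Lowering the exponent of \<open>i\<close> is injective on monomials that contain
  \<open>i\<close>, and the others have factor 0. This form has no truncated subtraction, so
  identities between derivatives can be checked coefficient by coefficient.\<close>

lemma lookup_partial_deriv:
  "Poly_Mapping.lookup (partial_deriv i f) m =
    real (Poly_Mapping.lookup m i + 1) * Poly_Mapping.lookup f (m + Poly_Mapping.single i 1)"
proof -
  let ?m = "m + Poly_Mapping.single i (1::nat)"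
  have eq: "m' - Poly_Mapping.single i 1 = m \<longleftrightarrow> m' = ?m" if "Poly_Mapping.lookup m' i > 0" for m'
    using that by (force simp: poly_mapping_eq_iff fun_eq_iff lookup_add lookup_minus lookup_single when_def)
  have "Poly_Mapping.lookup (partial_deriv i f) m =
    (\<Sum>m'\<in>insert ?m (Poly_Mapping.keys f).
      if m' = ?m then real (Poly_Mapping.lookup m i + 1) * Poly_Mapping.lookup f ?m else 0)"
    unfolding partial_deriv_superset[of "insert ?m (Poly_Mapping.keys f)" f i,
        OF finite.insertI[OF finite_keys] subset_insertI]
      lookup_sum lookup_single
  proof (intro sum.cong refl)
    fix m'
    show "(real (Poly_Mapping.lookup m' i) * Poly_Mapping.lookup f m' when m' - Poly_Mapping.single i 1 = m) =
      (if m' = ?m then real (Poly_Mapping.lookup m i + 1) * Poly_Mapping.lookup f ?m else 0)"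
      using eq[of m'] by (cases "Poly_Mapping.lookup m' i = 0") (auto simp: when_def lookup_add lookup_single)
  qed
  then show ?thesis by simp
qed

lemma partial_deriv_const_mult: "partial_deriv i (const c * f) = const c * partial_deriv i f"
  by (rule poly_mapping_eqI) (simp add: lookup_partial_deriv)

lemma partial_deriv_zero [simp]: "partial_deriv i 0 = 0"
  by (rule poly_mapping_eqI) (simp add: lookup_partial_deriv)

lemma partial_deriv_sum: "partial_deriv i (\<Sum>x\<in>A. f x) = (\<Sum>x\<in>A. partial_deriv i (f x))"
  by (rule poly_mapping_eqI) (simp add: lookup_partial_deriv lookup_sum sum_distrib_left)

lemma partial_deriv_commute:
  "partial_deriv i (partial_deriv j f) = partial_deriv j (partial_deriv i f)"
  by (rule poly_mapping_eqI)
     (auto simp: lookup_partial_deriv lookup_add lookup_single when_def add_ac)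

lemma partial_deriv_single:
  "partial_deriv i (Poly_Mapping.single m c) =
    Poly_Mapping.single (m - Poly_Mapping.single i 1) (real (Poly_Mapping.lookup m i) * c)"
  by (subst partial_deriv_superset[of "{m}"]) auto

lemma dir_deriv_zero [simp]: "dir_deriv V v 0 = 0"
  by (simp add: dir_deriv_def)

lemma dir_deriv_lin:
  "dir_deriv V (\<lambda>i. a * u i + b * v i) f =
    const a * dir_deriv V u f + const b * dir_deriv V v f"
  by (simp add: dir_deriv_def const_add const_mult algebra_simps sum.distrib sum_distrib_left)

lemma dir_deriv_commute: "dir_deriv V v (dir_deriv V w f) = dir_deriv V w (dir_deriv V v f)"
proof -
  have "dir_deriv V v (dir_deriv V w f) =
    (\<Sum>i\<in>V. \<Sum>j\<in>V. const (v i) * (const (w j) * partial_deriv i (partial_deriv j f)))"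
    by (simp add: dir_deriv_def partial_deriv_sum partial_deriv_const_mult sum_distrib_left)
  also have "\<dots> = (\<Sum>j\<in>V. \<Sum>i\<in>V. const (w j) * (const (v i) * partial_deriv j (partial_deriv i f)))"
    by (subst sum.swap) (intro sum.cong refl, simp add: partial_deriv_commute mult_ac)
  also have "\<dots> = dir_deriv V w (dir_deriv V v f)"
    by (simp add: dir_deriv_def partial_deriv_sum partial_deriv_const_mult sum_distrib_left)
  finally show ?thesis .
qed

lemma partial_deriv_dir_deriv:
  "partial_deriv i (dir_deriv V v f) = dir_deriv V v (partial_deriv i f)"
  by (simp add: dir_deriv_def partial_deriv_sum partial_deriv_const_mult partial_deriv_commute)

abbreviation dir_derivs :: "'v set \<Rightarrow> ('v \<Rightarrow> real) list \<Rightarrow> 'v real_mpoly \<Rightarrow> 'v real_mpoly" where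
  "dir_derivs V vs f \<equiv> foldr (dir_deriv V) vs f"

lemma dir_derivs_zero [simp]: "dir_derivs V vs 0 = 0"
  by (induction vs) auto

lemma partial_deriv_dir_derivs:
  "partial_deriv i (dir_derivs V vs f) = dir_derivs V vs (partial_deriv i f)"
  by (induction vs) (auto simp: partial_deriv_dir_deriv)

section \<open>Homogeneous polynomials and Euler's identity\<close>

definition homogeneous :: "nat \<Rightarrow> 'v real_mpoly \<Rightarrow> bool" where
  "homogeneous d f \<longleftrightarrow>
    (\<forall>m \<in> Poly_Mapping.keys f. (\<Sum>i\<in>Poly_Mapping.keys m. Poly_Mapping.lookup m i) = d)"

definition monom_eval :: "('v \<Rightarrow> real) \<Rightarrow> ('v \<Rightarrow>\<^sub>0 nat) \<Rightarrow> real" where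
  "monom_eval x m = (\<Prod>i\<in>Poly_Mapping.keys m. x i ^ Poly_Mapping.lookup m i)"

lemma evalp_superset:
  assumes "finite S" "Poly_Mapping.keys f \<subseteq> S"
  shows "evalp f x = (\<Sum>m\<in>S. Poly_Mapping.lookup f m * monom_eval x m)"
  unfolding evalp_def monom_eval_def
  by (rule sum.mono_neutral_left) (use assms in \<open>auto simp: in_keys_iff\<close>)

lemma evalp_zero [simp]: "evalp 0 x = 0"
  by (simp add: evalp_def)

lemma evalp_single: "evalp (Poly_Mapping.single m c) x = c * monom_eval x m"
  by (subst evalp_superset[of "{m}"]) auto

lemma evalp_add: "evalp (f + g) x = evalp f x + evalp g x"
proof -
  let ?S = "Poly_Mapping.keys f \<union> Poly_Mapping.keys g"
  have "evalp (f + g) x = (\<Sum>m\<in>?S. Poly_Mapping.lookup (f + g) m * monom_eval x m)"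
    using keys_add[of f g] by (intro evalp_superset) auto
  also have "\<dots> = evalp f x + evalp g x"
    by (simp add: evalp_superset[of ?S f] evalp_superset[of ?S g] lookup_add algebra_simps sum.distrib)
  finally show ?thesis .
qed

lemma evalp_const_mult: "evalp (const c * f) x = c * evalp f x"
proof -
  have "evalp (const c * f) x =
    (\<Sum>m\<in>Poly_Mapping.keys f. Poly_Mapping.lookup (const c * f) m * monom_eval x m)"
    by (intro evalp_superset) (auto simp: in_keys_iff)
  also have "\<dots> = c * evalp f x"
    by (simp add: evalp_superset[of "Poly_Mapping.keys f" f] sum_distrib_left mult.assoc)
  finally show ?thesis .
qed

lemma evalp_sum: "evalp (\<Sum>a\<in>A. f a) x = (\<Sum>a\<in>A. evalp (f a) x)"
  by (induction A rule: infinite_finite_induct) (simp_all add: evalp_add)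

lemma monom_eval_superset:
  assumes "finite S" "Poly_Mapping.keys m \<subseteq> S"
  shows "monom_eval x m = (\<Prod>i\<in>S. x i ^ Poly_Mapping.lookup m i)"
  unfolding monom_eval_def
  by (rule prod.mono_neutral_left) (use assms in \<open>auto simp: in_keys_iff\<close>)

text \<open>The operator \<open>x i\<close> times the derivative in \<open>i\<close> multiplies a
  monomial by its exponent of \<open>i\<close>; where that exponent is 0, the factor hides the
  truncated subtraction.\<close>

lemma euler_monomial:
  assumes "finite V" "Poly_Mapping.keys m \<subseteq> V"
  shows "(\<Sum>i\<in>V. x i * (real (Poly_Mapping.lookup m i) * monom_eval x (m - Poly_Mapping.single i 1))) =
    (\<Sum>i\<in>Poly_Mapping.keys m. real (Poly_Mapping.lookup m i)) * monom_eval x m"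
proof -
  have *: "x i * (real (Poly_Mapping.lookup m i) * monom_eval x (m - Poly_Mapping.single i 1)) =
    real (Poly_Mapping.lookup m i) * monom_eval x m" if "i \<in> V" for i
  proof (cases "Poly_Mapping.lookup m i")
    case (Suc k)
    have "Poly_Mapping.keys (m - Poly_Mapping.single i 1) \<subseteq> V"
      using assms(2) by (auto simp: in_keys_iff lookup_minus)
    then have "monom_eval x (m - Poly_Mapping.single i 1) =
      (\<Prod>j\<in>V. x j ^ Poly_Mapping.lookup (m - Poly_Mapping.single i 1) j)"
      by (rule monom_eval_superset[OF assms(1)])
    also have "\<dots> = x i ^ k * (\<Prod>j\<in>V-{i}. x j ^ Poly_Mapping.lookup m j)"
      by (subst prod.remove[OF assms(1) that]) (auto simp: lookup_minus lookup_single Suc intro!: prod.cong)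
    finally have "x i * monom_eval x (m - Poly_Mapping.single i 1) = (\<Prod>j\<in>V. x j ^ Poly_Mapping.lookup m j)"
      by (subst prod.remove[OF assms(1) that]) (simp add: Suc)
    then show ?thesis
      by (simp add: monom_eval_superset[OF assms])
  qed simp
  have "(\<Sum>i\<in>V. real (Poly_Mapping.lookup m i)) =
      (\<Sum>i\<in>Poly_Mapping.keys m. real (Poly_Mapping.lookup m i))"
    by (rule sum.mono_neutral_right) (use assms in \<open>auto simp: in_keys_iff\<close>)
  moreover have "(\<Sum>i\<in>V. x i * (real (Poly_Mapping.lookup m i) * monom_eval x (m - Poly_Mapping.single i 1))) =
    (\<Sum>i\<in>V. real (Poly_Mapping.lookup m i) * monom_eval x m)"
    by (intro sum.cong refl *)
  ultimately show ?thesis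
    by (simp flip: sum_distrib_right)
qed

lemma euler_homogeneous:
  assumes "finite V" "vars f \<subseteq> V" "homogeneous d f"
  shows "evalp (dir_deriv V x f) x = real d * evalp f x"
proof -
  have "partial_deriv i f = (\<Sum>m\<in>Poly_Mapping.keys f. Poly_Mapping.single (m - Poly_Mapping.single i 1)
       (real (Poly_Mapping.lookup m i) * Poly_Mapping.lookup f m))" for i
    by (rule partial_deriv_def)
  then have "evalp (dir_deriv V x f) x =
    (\<Sum>i\<in>V. \<Sum>m\<in>Poly_Mapping.keys f. Poly_Mapping.lookup f m *
      (x i * (real (Poly_Mapping.lookup m i) * monom_eval x (m - Poly_Mapping.single i 1))))"
    by (simp add: dir_deriv_def evalp_sum evalp_const_mult evalp_single sum_distrib_left mult_ac)
  also have "\<dots> = (\<Sum>m\<in>Poly_Mapping.keys f. Poly_Mapping.lookup f m *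
    (\<Sum>i\<in>V. x i * (real (Poly_Mapping.lookup m i) * monom_eval x (m - Poly_Mapping.single i 1))))"
    by (subst sum.swap) (simp add: sum_distrib_left)
  also have "\<dots> = (\<Sum>m\<in>Poly_Mapping.keys f. Poly_Mapping.lookup f m * (real d * monom_eval x m))"
  proof (intro sum.cong refl)
    fix m assume m: "m \<in> Poly_Mapping.keys f"
    then have "Poly_Mapping.keys m \<subseteq> V" using assms(2) by (auto simp: vars_def)
    moreover have "(\<Sum>i\<in>Poly_Mapping.keys m. real (Poly_Mapping.lookup m i)) = real d"
      using assms(3) m unfolding homogeneous_def by (metis of_nat_sum)
    ultimately show "Poly_Mapping.lookup f m *
    (\<Sum>i\<in>V. x i * (real (Poly_Mapping.lookup m i) * monom_eval x (m - Poly_Mapping.single i 1))) =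
      Poly_Mapping.lookup f m * (real d * monom_eval x m)"
      by (simp add: euler_monomial[OF assms(1)] del: One_nat_def)
  qed
  also have "\<dots> = real d * evalp f x"
    by (simp add: evalp_def monom_eval_def sum_distrib_left mult_ac)
  finally show ?thesis .
qed

lemma homogeneous_const_mult_sum:
  assumes "\<And>i. i \<in> A \<Longrightarrow> homogeneous d (f i)" 
  shows "homogeneous d (\<Sum>i\<in>A. const (c i) * f i)"
  unfolding homogeneous_def
proof
  fix m assume "m \<in> Poly_Mapping.keys (\<Sum>i\<in>A. const (c i) * f i)"
  then have "(\<Sum>i\<in>A. c i * Poly_Mapping.lookup (f i) m) \<noteq> 0"
    by (simp add: in_keys_iff lookup_sum)
  then obtain i where "i \<in> A" "c i * Poly_Mapping.lookup (f i) m \<noteq> 0"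
    by (meson sum.neutral)
  then show "(\<Sum>i\<in>Poly_Mapping.keys m. Poly_Mapping.lookup m i) = d"
    using assms by (auto simp: homogeneous_def in_keys_iff)
qed

lemma vars_partial_deriv: "vars (partial_deriv i f) \<subseteq> vars f"
proof -
  have "j \<in> vars f" if "m \<in> Poly_Mapping.keys (partial_deriv i f)" "j \<in> Poly_Mapping.keys m" for m j
  proof -
    have "m + Poly_Mapping.single i 1 \<in> Poly_Mapping.keys f"
      "j \<in> Poly_Mapping.keys (m + Poly_Mapping.single i 1)"
      using that by (auto simp: in_keys_iff lookup_partial_deriv lookup_add)
    then show ?thesis by (auto simp: vars_def)
  qed
  then show ?thesis by (auto simp: vars_def[of "partial_deriv i f"])
qed

lemma vars_dir_deriv: "vars (dir_deriv V v f) \<subseteq> vars f"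
proof -
  have "j \<in> vars f" if m: "m \<in> Poly_Mapping.keys (dir_deriv V v f)" and j: "j \<in> Poly_Mapping.keys m" for m j
  proof -
    from m have "(\<Sum>i\<in>V. v i * Poly_Mapping.lookup (partial_deriv i f) m) \<noteq> 0"
      by (simp add: in_keys_iff dir_deriv_def lookup_sum)
    then obtain i where "v i * Poly_Mapping.lookup (partial_deriv i f) m \<noteq> 0"
      by (meson sum.neutral)
    then have "j \<in> vars (partial_deriv i f)" using j by (auto simp: vars_def in_keys_iff)
    then show ?thesis using vars_partial_deriv by fastforce
  qed
  then show ?thesis by (auto simp: vars_def[of "dir_deriv V v f"])
qed

lemma homogeneous_partial_deriv:
  assumes "homogeneous (Suc d) f"
  shows "homogeneous d (partial_deriv i f)"
  unfolding homogeneous_def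
proof
  fix m assume m: "m \<in> Poly_Mapping.keys (partial_deriv i f)"
  let ?m = "m + Poly_Mapping.single i (1::nat)"
  have "?m \<in> Poly_Mapping.keys f" using m by (auto simp: in_keys_iff lookup_partial_deriv)
  then have "(\<Sum>j\<in>Poly_Mapping.keys ?m. Poly_Mapping.lookup ?m j) = Suc d"
    using assms by (auto simp: homogeneous_def)
  moreover have "(\<Sum>j\<in>Poly_Mapping.keys ?m. Poly_Mapping.lookup ?m j) =
    (\<Sum>j\<in>insert i (Poly_Mapping.keys m). Poly_Mapping.lookup ?m j)"
    by (rule sum.mono_neutral_left) (auto simp: in_keys_iff lookup_add lookup_single when_def split: if_splits)
  moreover have "\<dots> = (\<Sum>j\<in>insert i (Poly_Mapping.keys m). Poly_Mapping.lookup m j) + 1"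
    by (simp add: lookup_add sum.distrib lookup_single when_def)
  moreover have "(\<Sum>j\<in>insert i (Poly_Mapping.keys m). Poly_Mapping.lookup m j) =
      (\<Sum>j\<in>Poly_Mapping.keys m. Poly_Mapping.lookup m j)"
    by (rule sum.mono_neutral_right) (auto simp: in_keys_iff)
  ultimately show "(\<Sum>i\<in>Poly_Mapping.keys m. Poly_Mapping.lookup m i) = d" by simp
qed

lemma homogeneous_dir_deriv:
  "homogeneous (Suc d) f \<Longrightarrow> homogeneous d (dir_deriv V v f)"
  unfolding dir_deriv_def by (intro homogeneous_const_mult_sum homogeneous_partial_deriv)

lemma homogeneous_0_partial_deriv:
  assumes "homogeneous 0 f"
  shows "partial_deriv i f = 0"
proof (rule poly_mapping_eqI)
  fix m
  let ?m = "m + Poly_Mapping.single i (1::nat)"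
  have "?m \<notin> Poly_Mapping.keys f"
  proof
    assume "?m \<in> Poly_Mapping.keys f"
    then have "(\<Sum>j\<in>Poly_Mapping.keys ?m. Poly_Mapping.lookup ?m j) = 0"
      using assms by (auto simp: homogeneous_def)
    moreover have "i \<in> Poly_Mapping.keys ?m" by (simp add: in_keys_iff lookup_add)
    ultimately show False by (auto simp: lookup_add)
  qed
  then show "Poly_Mapping.lookup (partial_deriv i f) m = Poly_Mapping.lookup 0 m"
    by (auto simp: lookup_partial_deriv in_keys_iff)
qed

lemma evalp_homogeneous_0:
  assumes "homogeneous 0 f"
  shows "evalp f x = Poly_Mapping.lookup f 0"
proof -
  have "Poly_Mapping.keys f \<subseteq> {0}"
  proof
    fix m assume "m \<in> Poly_Mapping.keys f"
    then have "\<forall>i\<in>Poly_Mapping.keys m. Poly_Mapping.lookup m i = 0"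
      using assms by (auto simp: homogeneous_def)
    then have "m = 0" by (auto intro!: poly_mapping_eqI simp: in_keys_iff)
    then show "m \<in> {0}" by simp
  qed
  then have "evalp f x = (\<Sum>m\<in>{0}. Poly_Mapping.lookup f m * monom_eval x m)"
    by (intro evalp_superset) auto
  then show ?thesis by (simp add: monom_eval_def)
qed

lemma vars_dir_derivs: "vars (dir_derivs V vs f) \<subseteq> vars f"
  by (induction vs) (use vars_dir_deriv in fastforce)+

lemma homogeneous_dir_derivs:
  "homogeneous (length vs + d) f \<Longrightarrow> homogeneous d (dir_derivs V vs f)"
  by (induction vs arbitrary: d) (auto intro: homogeneous_dir_deriv)

text \<open>Euler's identity iterated \<open>d\<close> times. It turns statements about values into
  statements about constant coefficients of mixed derivatives.\<close>

lemma evalp_homogeneous: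
  assumes "finite V" "vars f \<subseteq> V" "homogeneous d f"
  shows "fact d * evalp f x = Poly_Mapping.lookup ((dir_deriv V x ^^ d) f) 0"
  using assms(2,3)
proof (induction d arbitrary: f)
  case 0
  then show ?case by (simp add: evalp_homogeneous_0)
next
  case (Suc d)
  have "fact (Suc d) * evalp f x = fact d * evalp (dir_deriv V x f) x"
    using Suc.prems by (simp add: euler_homogeneous[OF assms(1)])
  also have "\<dots> = Poly_Mapping.lookup ((dir_deriv V x ^^ d) (dir_deriv V x f)) 0"
    using Suc.prems vars_dir_deriv[of V x f] by (intro Suc.IH homogeneous_dir_deriv) auto
  finally show ?case by (simp add: funpow_swap1)
qed

subsection \<open>Reverse Cauchy--Schwarz inequalities\<close>

lemma lookup_dir_deriv:
  "Poly_Mapping.lookup (dir_deriv V v f) m = (\<Sum>i\<in>V. v i * Poly_Mapping.lookup (partial_deriv i f) m)"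
  by (simp add: dir_deriv_def lookup_sum)

text \<open>For a quadratic form this is the symmetric bilinear form whose diagonal is twice the
  form.\<close>

definition polar :: "'v set \<Rightarrow> 'v real_mpoly \<Rightarrow> ('v \<Rightarrow> real) \<Rightarrow> ('v \<Rightarrow> real) \<Rightarrow> real" where
  "polar V f x y = Poly_Mapping.lookup (dir_deriv V x (dir_deriv V y f)) 0"

lemma polar_sum:
  "polar V f x y =
    (\<Sum>i\<in>V. \<Sum>j\<in>V. x i * y j * Poly_Mapping.lookup (partial_deriv i (partial_deriv j f)) 0)"
  by (simp add: polar_def lookup_dir_deriv partial_deriv_dir_deriv partial_deriv_commute
      sum_distrib_left mult.assoc)

lemma polar_commute: "polar V f x y = polar V f y x"
  by (simp add: polar_def dir_deriv_commute)

lemma polar_diff_scaled: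
  "polar V f (\<lambda>i. x i - t * a i) y = polar V f x y - t * polar V f a y"
  using dir_deriv_lin[of V 1 x "- t" a] by (simp add: polar_def lookup_add algebra_simps)

text \<open>Where \<open>polar V f a a\<close> is positive, the inequality says that the form is
  nonpositive on the orthogonal complement of \<open>a\<close> with respect to
  \<open>polar\<close>.\<close>

definition lorentzian :: "'v set \<Rightarrow> 'v real_mpoly \<Rightarrow> bool" where
  "lorentzian V f \<longleftrightarrow>
    (\<forall>a x. (\<forall>i\<in>V. 0 < a i) \<longrightarrow> polar V f x x * polar V f a a \<le> (polar V f x a)\<^sup>2)"

text \<open>A hyperplane that avoids all positive vectors and on which the form is nonpositive
  suffices: moving \<open>x\<close> along \<open>a\<close> into the hyperplane and completing the
  square gives the inequality.\<close>

lemma lorentzianI: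
  assumes neg: "\<And>x. L x = 0 \<Longrightarrow> polar V f x x \<le> 0"
    and lin: "\<And>x a t. L (\<lambda>i. x i - t * a i) = L x - t * L a"
    and pos: "\<And>a. (\<And>i. i \<in> V \<Longrightarrow> 0 < a i) \<Longrightarrow> 0 < L a"
    and nonneg: "\<And>a. (\<And>i. i \<in> V \<Longrightarrow> 0 < a i) \<Longrightarrow> 0 \<le> polar V f a a"
  shows "lorentzian V f"
  unfolding lorentzian_def
proof (intro allI impI)
  fix a x :: "'a \<Rightarrow> real"
  assume "\<forall>i\<in>V. 0 < a i"
  then have "L a > 0" and aa: "polar V f a a \<ge> 0" by (auto intro: pos nonneg)
  define t where "t = L x / L a"
  define y where "y i = x i - t * a i" for i
  have "L y = 0" using \<open>L a > 0\<close> unfolding y_def lin by (simp add: t_def)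
  then have "polar V f y y \<le> 0" by (rule neg)
  moreover have "polar V f y y = polar V f x x - 2 * t * polar V f x a + t\<^sup>2 * polar V f a a"
  proof -
    have diff: "polar V f y z = polar V f x z - t * polar V f a z" for z
      unfolding y_def by (rule polar_diff_scaled)
    have "polar V f y y = polar V f y x - t * polar V f y a"
      using diff[of y] polar_commute[of V f x y] polar_commute[of V f a y] by simp
    also have "\<dots> = polar V f x x - t * polar V f x a - t * (polar V f x a - t * polar V f a a)"
      unfolding diff by (simp add: polar_commute[of V f a x])
    finally show ?thesis by (simp add: algebra_simps power2_eq_square)
  qed
  ultimately have "polar V f a a * (polar V f x x - 2 * t * polar V f x a + t\<^sup>2 * polar V f a a) \<le> 0"
    using aa by (simp add: mult_nonneg_nonpos)
  moreover have "0 \<le> (polar V f x a - t * polar V f a a)\<^sup>2" by simp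
  ultimately show "polar V f x x * polar V f a a \<le> (polar V f x a)\<^sup>2"
    by (simp add: algebra_simps power2_eq_square)
qed

text \<open>The data for the induction on the degree \<open>d\<close>. The derivative in
  \<open>y\<close> always stays in the class, and by \<open>class_const\<close> the class then never
  contains 0, so \<open>y\<close> can serve as the hub of the walk. Quadrics are the base
  case.\<close>

locale lorentzian_class =
  fixes V :: "'v set" and y :: 'v and C :: "nat \<Rightarrow> 'v real_mpoly \<Rightarrow> bool"
  assumes finite_V: "finite V" and y_in_V: "y \<in> V"
    and class_homogeneous: "C d f \<Longrightarrow> homogeneous d f"
    and class_vars: "C d f \<Longrightarrow> vars f \<subseteq> V"
    and class_const: "C 0 f \<Longrightarrow> 0 < Poly_Mapping.lookup f 0"
    and class_deriv_y: "C (Suc d) f \<Longrightarrow> C d (partial_deriv y f)"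
    and class_deriv: "C (Suc d) f \<Longrightarrow> i \<in> V \<Longrightarrow> partial_deriv i f = 0 \<or> C d (partial_deriv i f)"
    and class_quadratic: "C 2 f \<Longrightarrow> lorentzian V f"
begin

definition positive :: "('v \<Rightarrow> real) \<Rightarrow> bool" where
  "positive w \<longleftrightarrow> (\<forall>i\<in>V. 0 < w i)"

text \<open>Expanding the outermost derivative over the coordinates, the term of \<open>y\<close> is
  positive and the others are nonnegative by induction.\<close>

lemma mixed_pos:
  assumes "C (length ws) f" "\<forall>w\<in>set ws. positive w"
  shows "0 < Poly_Mapping.lookup (dir_derivs V ws f) 0"
  using assms
proof (induction ws arbitrary: f)
  case Nil
  then show ?case by (simp add: class_const)
next
  case (Cons w ws)
  have "0 \<le> Poly_Mapping.lookup (dir_derivs V ws (partial_deriv i f)) 0" if "i \<in> V" for i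
    using class_deriv[of "length ws" f i] Cons that by fastforce
  moreover have "0 < Poly_Mapping.lookup (dir_derivs V ws (partial_deriv y f)) 0"
    using class_deriv_y[of "length ws" f] Cons by auto
  ultimately have "0 < (\<Sum>i\<in>V. w i * Poly_Mapping.lookup (dir_derivs V ws (partial_deriv i f)) 0)"
    using Cons.prems(2) y_in_V by (intro sum_pos2[OF finite_V y_in_V]) (auto simp: positive_def)
  then show ?case by (simp add: lookup_dir_deriv partial_deriv_dir_derivs)
qed

lemma mixed_nonneg:
  assumes "f = 0 \<or> C (length ws) f" "\<forall>w\<in>set ws. positive w"
  shows "0 \<le> Poly_Mapping.lookup (dir_derivs V ws f) 0"
  using assms mixed_pos by fastforce

text \<open>
  The Bochner method: writing \<open>q = D\<^sub>w h\<close>, the reverse Cauchy--Schwarz inequalities of the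
  \<open>\<partial>\<^sub>i h\<close> against \<open>w\<close> add up to the inequality \<open>P \<le> P\<^sup>2\<close> for the Markov operator \<open>P\<close> with weights
  \<open>w i * w j * \<partial>\<^sub>i \<partial>\<^sub>j q\<close>.
\<close>

lemma mixed_lorentzian:
  assumes "C (length ws + 2) f" "\<forall>w\<in>set ws. positive w"
  shows "lorentzian V (dir_derivs V ws f)"
  using assms
proof (induction ws arbitrary: f)
  case Nil
  then show ?case by (simp add: class_quadratic numeral_2_eq_2)
next
  case (Cons w ws)
  define h where "h = dir_derivs V ws f"
  define q where "q = dir_deriv V w h"
  \<comment> \<open>The walk lives on the variables that occur in \<open>f\<close>: there all row
    sums are positive, while all other rows and columns of \<open>a\<close> vanish.\<close>
  define U where "U = {i\<in>V. partial_deriv i f \<noteq> 0}"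
  \<comment> \<open>The Hessian of \<open>q\<close>, which is constant because \<open>q\<close> has
    degree 2.\<close>
  define a where "a i j = Poly_Mapping.lookup (partial_deriv i (partial_deriv j q)) 0" for i j
  have fin: "finite U" using finite_V by (simp add: U_def)
  have w: "w i > 0" if "i \<in> V" for i using Cons.prems that by (simp add: positive_def)
  have f: "C (Suc (Suc (Suc (length ws)))) f" using Cons.prems by (simp add: numeral_eq_Suc)
  have q: "q = dir_derivs V (w # ws) f" by (simp add: q_def h_def)
  have a_sym: "a i j = a j i" for i j by (simp add: a_def partial_deriv_commute)
  have deriv2_q: "partial_deriv i (partial_deriv j q) =
      dir_derivs V (w # ws) (partial_deriv i (partial_deriv j f))" for i j
    by (simp add: q partial_deriv_dir_derivs partial_deriv_dir_deriv)
  have a_nonneg: "a i j \<ge> 0" if "i \<in> V" "j \<in> V" for i j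
  proof -
    have "partial_deriv i (partial_deriv j f) = 0 \<or>
        C (Suc (length ws)) (partial_deriv i (partial_deriv j f))"
      using class_deriv[OF f that(2)] class_deriv[OF _ that(1)] by auto
    then show ?thesis
      unfolding a_def deriv2_q using Cons.prems by (intro mixed_nonneg) auto
  qed
  have a_pos: "a y i > 0" if "i \<in> U" for i
  proof -
    have "C (Suc (length ws)) (partial_deriv y (partial_deriv i f))"
      using class_deriv[OF f] class_deriv_y that by (auto simp: U_def)
    then show ?thesis
      unfolding a_def deriv2_q using Cons.prems by (intro mixed_pos) auto
  qed
  have a_zero: "a i j = 0" if "i \<in> V" "j \<in> V" "i \<notin> U \<or> j \<notin> U" for i j
  proof -
    have "partial_deriv i (partial_deriv j f) = 0"
      using that partial_deriv_commute[of i j f] by (auto simp: U_def)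
    then show ?thesis by (simp add: a_def deriv2_q)
  qed
  \<comment> \<open>Otherwise the zero polynomial would lie in the class, contradicting
    \<open>mixed_pos\<close>.\<close>
  have "partial_deriv y f \<noteq> 0"
  proof
    assume "partial_deriv y f = 0"
    then have "C (Suc (length ws)) 0" using class_deriv_y[OF class_deriv_y[OF f]] by simp
    then show False using mixed_pos[of "w # ws" 0] Cons.prems by auto
  qed
  then have y: "y \<in> U" using y_in_V by (simp add: U_def)
  have "U \<subseteq> V" by (auto simp: U_def)
  have row_sum: "(\<Sum>j\<in>V. x j * a i j) = (\<Sum>j\<in>U. x j * a i j)" if "i \<in> V" for x i
    by (rule sum.mono_neutral_right) (use finite_V \<open>U \<subseteq> V\<close> that in \<open>auto simp: a_zero\<close>)
  have polar_q: "polar V q x z = (\<Sum>i\<in>U. \<Sum>j\<in>U. x i * z j * a i j)" for x z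
  proof -
    have "polar V q x z = (\<Sum>i\<in>V. x i * (\<Sum>j\<in>V. z j * a i j))"
      by (simp add: polar_sum a_def sum_distrib_left mult.assoc)
    also have "\<dots> = (\<Sum>i\<in>V. x i * (\<Sum>j\<in>U. z j * a i j))"
      by (simp add: row_sum)
    also have "\<dots> = (\<Sum>i\<in>U. x i * (\<Sum>j\<in>U. z j * a i j))"
      by (rule sum.mono_neutral_right)
         (use finite_V \<open>U \<subseteq> V\<close> in \<open>auto intro!: sum.neutral simp: a_zero subset_iff\<close>)
    finally show ?thesis by (simp add: sum_distrib_left mult.assoc)
  qed
  define p where "p i j = w i * w j * a i j" for i j
  define r where "r i = (\<Sum>j\<in>U. p i j)" for i
  have p_nonneg: "0 \<le> p i j" if "i \<in> U" "j \<in> U" for i j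
    unfolding p_def using that w[of i] w[of j] a_nonneg[of i j] \<open>U \<subseteq> V\<close>
    by (simp add: subset_iff)
  have p_sym: "p i j = p j i" for i j by (simp add: p_def a_sym[of i j] mult.commute)
  have p_pos: "0 < p y i" if "i \<in> U" for i
    unfolding p_def using that w[of i] w[of y] a_pos[of i] y \<open>U \<subseteq> V\<close>
    by (simp add: subset_iff)
  have polar_h: "polar V (partial_deriv i h) x w = (\<Sum>j\<in>U. x j * a i j)" if "i \<in> V" for i x
  proof -
    have "polar V (partial_deriv i h) x w = Poly_Mapping.lookup (dir_deriv V x (partial_deriv i q)) 0"
      by (simp add: polar_def q_def partial_deriv_dir_deriv)
    also have "\<dots> = (\<Sum>j\<in>V. x j * a i j)"
      by (simp add: lookup_dir_deriv a_def partial_deriv_commute)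
    finally show ?thesis using row_sum[OF that] by simp
  qed
  \<comment> \<open>Thus the row sums are, up to \<open>w i\<close>, the second factors in the
    reverse Cauchy--Schwarz inequalities against \<open>w\<close>.\<close>
  have r: "r i = w i * polar V (partial_deriv i h) w w" if "i \<in> V" for i
    by (simp add: r_def p_def polar_h[OF that] sum_distrib_left mult.assoc)
  have r_pos: "r i > 0" if "i \<in> U" for i
    unfolding r_def
  proof (rule sum_pos2[OF fin y])
    show "0 < p i y" using p_pos[OF that] p_sym[of i y] by simp
    show "0 \<le> p i j" if "j \<in> U" for j
      using \<open>i \<in> U\<close> that by (rule p_nonneg)
  qed
  have neg: "polar V q x x \<le> 0" if orth: "polar V q x w = 0" for x
  proof -
    \<comment> \<open>In these coordinates \<open>w\<close> becomes the constant vector 1, so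
      orthogonality to \<open>w\<close> becomes orthogonality to the constants.\<close>
    define \<xi> where "\<xi> i = x i / w i" for i
    have x: "x i = w i * \<xi> i" if "i \<in> U" for i
      using w[of i] that \<open>U \<subseteq> V\<close> by (auto simp: \<xi>_def)
    have "(\<Sum>i\<in>U. \<Sum>j\<in>U. p i j * \<xi> i * \<xi> j) \<le> 0"
    proof (rule reversible_walk_spectral_gap[where r = r and hub = y])
      have "polar V q x w = (\<Sum>i\<in>U. \<Sum>j\<in>U. p i j * \<xi> i)"
        unfolding polar_q by (intro sum.cong refl) (simp add: x p_def)
      also have "\<dots> = (\<Sum>i\<in>U. r i * \<xi> i)"
        by (simp add: r_def sum_distrib_right)
      finally show "(\<Sum>i\<in>U. r i * \<xi> i) = 0" using orth by simp
      show "(\<Sum>i\<in>U. \<Sum>j\<in>U. p i j * \<xi> i * \<xi> j) \<le> (\<Sum>i\<in>U. (\<Sum>j\<in>U. p i j * \<xi> j)^2 / r i)" for \<xi>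
      proof -
        define x where "x i = w i * \<xi> i" for i
        have "(\<Sum>i\<in>U. \<Sum>j\<in>U. p i j * \<xi> i * \<xi> j) = polar V q x x"
          unfolding polar_q x_def p_def by (simp add: mult_ac)
        also have "\<dots> = (\<Sum>i\<in>V. w i * polar V (partial_deriv i h) x x)"
        proof -
          \<comment> \<open>Taking the derivative along \<open>w\<close> last splits the form into
            the forms of the partial derivatives of \<open>h\<close>.\<close>
          have "polar V q x x = Poly_Mapping.lookup (dir_deriv V w (dir_deriv V x (dir_deriv V x h))) 0"
            by (simp add: polar_def q_def dir_deriv_commute)
          then show ?thesis by (simp add: lookup_dir_deriv[of V w] partial_deriv_dir_deriv polar_def)
        qed
        also have "\<dots> = (\<Sum>i\<in>U. w i * polar V (partial_deriv i h) x x)"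
          by (rule sum.mono_neutral_right)
             (use finite_V in \<open>auto simp: U_def h_def partial_deriv_dir_derivs polar_def\<close>)
        also have "\<dots> \<le> (\<Sum>i\<in>U. (\<Sum>j\<in>U. p i j * \<xi> j)^2 / r i)"
        proof (rule sum_mono)
          fix i assume i: "i \<in> U"
          then have iV: "i \<in> V" and wi: "w i > 0" using w \<open>U \<subseteq> V\<close> by auto
          have "C (length ws + 2) (partial_deriv i f)"
            using class_deriv[OF f iV] i by (simp add: U_def numeral_2_eq_2)
          then have "lorentzian V (partial_deriv i h)"
            unfolding h_def partial_deriv_dir_derivs using Cons.prems by (intro Cons.IH) auto
          then have "polar V (partial_deriv i h) x x * polar V (partial_deriv i h) w w
              \<le> (polar V (partial_deriv i h) x w)\<^sup>2"
            using w by (auto simp: lorentzian_def)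
          \<comment> \<open>The induction hypothesis multiplied by the square of
            \<open>w i\<close>.\<close>
          then have "w i * polar V (partial_deriv i h) x x * r i \<le> (w i * polar V (partial_deriv i h) x w)\<^sup>2"
            using wi by (simp add: r[OF iV] power2_eq_square mult.left_commute mult.assoc)
          moreover have "w i * polar V (partial_deriv i h) x w = (\<Sum>j\<in>U. p i j * \<xi> j)"
            unfolding polar_h[OF iV] sum_distrib_left by (intro sum.cong refl) (simp add: p_def x_def)
          ultimately show "w i * polar V (partial_deriv i h) x x \<le> (\<Sum>j\<in>U. p i j * \<xi> j)^2 / r i"
            using r_pos[OF i] by (simp add: pos_le_divide_eq)
        qed
        finally show ?thesis .
      qed
      show "0 < p y i" if "i \<in> U" for i by (rule p_pos[OF that])
    qed (fact fin p_sym p_nonneg r_def r_pos y)+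
    moreover have "polar V q x x = (\<Sum>i\<in>U. \<Sum>j\<in>U. p i j * \<xi> i * \<xi> j)"
      unfolding polar_q by (intro sum.cong refl) (simp add: x p_def)
    ultimately show ?thesis by simp
  qed
  have polar_pos: "polar V q x z > 0" if "positive x" "positive z" for x z
  proof -
    have "polar V q x z = Poly_Mapping.lookup (dir_derivs V (x # z # w # ws) f) 0"
      by (simp add: polar_def q)
    also have "\<dots> > 0" by (rule mixed_pos) (use that f Cons.prems in auto)
    finally show ?thesis .
  qed
  have "lorentzian V q"
  proof (rule lorentzianI[where L = "\<lambda>x. polar V q x w"])
    fix a :: "'v \<Rightarrow> real" assume "\<And>i. i \<in> V \<Longrightarrow> 0 < a i"
    then have a: "positive a" by (simp add: positive_def)
    show "0 < polar V q a w" using a Cons.prems by (intro polar_pos) auto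
    show "0 \<le> polar V q a a" using polar_pos[OF a a] by simp
  qed (fact neg polar_diff_scaled)+
  then show ?case by (simp add: q)
qed

text \<open>Reverse Cauchy--Schwarz for the directions \<open>u\<close> and \<open>x\<close>,
  applied to the quadric left after all the common derivatives.\<close>

lemma mixed_log_concave_seq:
  assumes C: "C (length vs + j + k + 2) f"
    and pos: "\<forall>w\<in>set vs. positive w" "positive u" "positive x"
  defines "F \<equiv> \<lambda>a b.
    Poly_Mapping.lookup ((dir_deriv V u ^^ a) ((dir_deriv V x ^^ b) (dir_derivs V vs f))) 0"
  shows "F (j + 2) k * F j (k + 2) \<le> (F (j + 1) (k + 1))\<^sup>2"
proof -
  define g where "g = dir_derivs V (replicate j u @ replicate k x @ vs) f"
  have "lorentzian V g"
    unfolding g_def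
  proof (rule mixed_lorentzian)
    have "length (replicate j u @ replicate k x @ vs) + 2 = length vs + j + k + 2" by simp
    then show "C (length (replicate j u @ replicate k x @ vs) + 2) f" using C by (simp only:)
    show "\<forall>w\<in>set (replicate j u @ replicate k x @ vs). positive w"
      using pos by auto
  qed
  have g: "g = (dir_deriv V u ^^ j) ((dir_deriv V x ^^ k) (dir_derivs V vs f))"
    by (simp add: g_def)
  have comm: "(dir_deriv V u ^^ j) (dir_deriv V x h) = dir_deriv V x ((dir_deriv V u ^^ j) h)" for h
    by (induction j) (simp_all add: dir_deriv_commute[of V u x])
  have "F (j + 2) k = polar V g u u" "F j (k + 2) = polar V g x x" "F (j + 1) (k + 1) = polar V g u x"
    unfolding F_def polar_def g by (simp_all add: comm)
  moreover have "polar V g u u * polar V g x x \<le> (polar V g u x)\<^sup>2"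
    using \<open>lorentzian V g\<close> pos unfolding lorentzian_def positive_def by blast
  ultimately show ?thesis by simp
qed

end

text \<open>The increments of a concave sequence decrease, so each of them is at most the
  first.\<close>

lemma concave_seq_slope:
  fixes b :: "nat \<Rightarrow> real"
  assumes "\<And>i. i + 2 \<le> m \<Longrightarrow> b i + b (i + 2) \<le> 2 * b (i + 1)"
  shows "b m - b 0 \<le> real m * (b 1 - b 0)"
proof -
  have step: "b (Suc i) - b i \<le> b 1 - b 0" if "Suc i \<le> m" for i
    using that
  proof (induction i)
    case (Suc i)
    then show ?case using assms[of i] by simp
  qed simp
  have "b i - b 0 \<le> real i * (b 1 - b 0)" if "i \<le> m" for i
    using that
  proof (induction i)
    case (Suc i)
    then show ?case using step[of i] by (simp add: algebra_simps)
  qed simp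
  then show ?thesis by simp
qed

subsection \<open>Log-concavity\<close>

lemma dir_derivs_eq_0:
  assumes "homogeneous d f" "d < length vs"
  shows "dir_derivs V vs f = 0"
  using assms
proof (induction vs)
  case (Cons v vs)
  show ?case
  proof (cases "d < length vs")
    case False
    then have "homogeneous 0 (dir_derivs V vs f)"
      using Cons.prems by (intro homogeneous_dir_derivs) (simp add: less_Suc_eq)
    then show ?thesis by (simp add: dir_deriv_def[of V v] homogeneous_0_partial_deriv)
  qed (use Cons in simp)
qed simp

text \<open>This carries inequalities from the positive vectors \<open>w + e\<close> to nonnegative
  \<open>w\<close> as \<open>e\<close> tends to 0.\<close>

lemma continuous_mixed_shift:
  "continuous_on UNIV (\<lambda>e. Poly_Mapping.lookup (dir_derivs V (map (\<lambda>w i. w i + e) ws) f) m)"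
proof (induction ws arbitrary: m)
  case Nil
  then show ?case by simp
next
  case (Cons w ws)
  show ?case
    unfolding list.map foldr.simps comp_def lookup_dir_deriv lookup_partial_deriv
    by (intro continuous_intros Cons.IH)
qed

context lorentzian_class
begin

text \<open>Let \<open>x\<close> be the convex combination. Replacing its copies by \<open>w\<close>
  one at a time gives a log-concave sequence from \<open>F x\<close> to \<open>F w\<close>, so the
  first replacement \<open>Y w\<close> controls \<open>F w\<close>. As \<open>Y\<close> is linear in
  \<open>w\<close>, weighted arithmetic and geometric means finish the argument.\<close>

lemma mixed_log_concave_pos:
  assumes C: "C (length vs + m) f" and pos: "\<forall>w\<in>set vs. positive w" "positive u" "positive v"
    and l: "0 \<le> l" "l \<le> 1"
  defines "F \<equiv> \<lambda>w. Poly_Mapping.lookup (dir_derivs V (replicate m w @ vs) f) 0"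
  shows "F u powr l * F v powr (1 - l) \<le> F (\<lambda>i. l * u i + (1 - l) * v i)"
proof (cases m)
  case 0
  have "F u > 0" unfolding F_def by (rule mixed_pos) (use assms 0 in auto)
  then have "F u powr l * F u powr (1 - l) \<le> F u" by (simp flip: powr_add)
  then show ?thesis by (simp add: F_def 0)
next
  case (Suc n)
  define x where "x i = l * u i + (1 - l) * v i" for i
  have x: "positive x"
    unfolding positive_def
  proof
    fix i assume "i \<in> V"
    then have "0 < u i" "0 < v i" using pos by (auto simp: positive_def)
    then show "0 < x i"
      using l unfolding x_def by (cases "l = 0") (auto intro: add_pos_nonneg)
  qed
  have F_pos: "0 < F w" if "positive w" for w
    unfolding F_def by (rule mixed_pos) (use assms that in \<open>auto simp: add.commute\<close>)
  define Y where "Y w =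
    Poly_Mapping.lookup (dir_deriv V w (dir_derivs V (replicate n x @ vs) f)) 0" for w
  have Y_pos: "0 < Y w" if "positive w" for w
  proof -
    have "Y w = Poly_Mapping.lookup (dir_derivs V (w # replicate n x @ vs) f) 0"
      by (simp add: Y_def)
    also have "\<dots> > 0" by (rule mixed_pos) (use assms that x Suc in \<open>auto simp: add.commute\<close>)
    finally show ?thesis .
  qed
  have slope: "ln (F w) - ln (F x) \<le> real m * (ln (Y w) - ln (F x))" if w: "positive w" for w
  proof -
    define G where "G j k =
      Poly_Mapping.lookup ((dir_deriv V w ^^ j) ((dir_deriv V x ^^ k) (dir_derivs V vs f))) 0" for j k
    \<comment> \<open>Here \<open>b 0\<close>, \<open>b 1\<close> and \<open>b m\<close> are the
      logarithms of \<open>F x\<close>, \<open>Y w\<close> and \<open>F w\<close>.\<close>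
    define b where "b j = ln (G j (m - j))" for j
    have G_pos: "0 < G j k" if "j + k = m" for j k
    proof -
      have "G j k = Poly_Mapping.lookup (dir_derivs V (replicate j w @ replicate k x @ vs) f) 0"
        by (simp add: G_def)
      also have "\<dots> > 0" by (rule mixed_pos) (use assms that w x in \<open>auto simp: add_ac\<close>)
      finally show ?thesis .
    qed
    have "b m - b 0 \<le> real m * (b 1 - b 0)"
    proof (rule concave_seq_slope)
      fix i assume "i + 2 \<le> m"
      then obtain k where k: "m = i + k + 2" by (metis add.assoc add.commute le_Suc_ex)
      have "G (i + 2) k * G i (k + 2) \<le> (G (i + 1) (k + 1))\<^sup>2"
        unfolding G_def by (rule mixed_log_concave_seq) (use C k pos w x in \<open>auto simp: add_ac\<close>)
      moreover have pos: "0 < G (i + 2) k" "0 < G i (k + 2)" "0 < G (i + 1) (k + 1)"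
        by (intro G_pos; simp add: k)+
      ultimately have "ln (G (i + 2) k * G i (k + 2)) \<le> ln ((G (i + 1) (k + 1))\<^sup>2)"
        by (subst ln_le_cancel_iff) (intro mult_pos_pos zero_less_power | assumption)+
      also have "\<dots> = 2 * ln (G (i + 1) (k + 1))"
        by (simp add: ln_realpow pos)
      also have "ln (G (i + 2) k * G i (k + 2)) = ln (G (i + 2) k) + ln (G i (k + 2))"
        by (rule ln_mult_pos[OF pos(1,2)])
      finally show "b i + b (i + 2) \<le> 2 * b (i + 1)"
        by (simp add: b_def k)
    qed
    moreover have "b m = ln (F w)" "b 0 = ln (F x)" "b 1 = ln (Y w)"
      by (simp_all add: b_def G_def F_def Y_def Suc)
    ultimately show ?thesis by simp
  qed
  have "Y u powr l * Y v powr (1 - l) \<le> l * Y u + (1 - l) * Y v"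
    using l Y_pos pos by (intro Youngs_inequality_0) auto
  also have "\<dots> = Y x"
    unfolding Y_def x_def[abs_def] by (simp only: dir_deriv_lin lookup_add lookup_const_mult)
  also have "Y x = F x" by (simp add: Y_def F_def Suc)
  finally have "ln (Y u powr l * Y v powr (1 - l)) \<le> ln (F x)"
    using Y_pos[of u] Y_pos[of v] pos F_pos[OF x] by (subst ln_le_cancel_iff) auto
  then have Y: "l * ln (Y u) + (1 - l) * ln (Y v) \<le> ln (F x)"
    using Y_pos[of u] Y_pos[of v] pos by (simp add: ln_mult_pos)
  \<comment> \<open>The slope bounds at \<open>u\<close> and \<open>v\<close> are averaged with
    weights \<open>l\<close> and \<open>1 - l\<close>, and \<open>Y\<close> bounds the
    result.\<close>
  have "l * ln (F u) + (1 - l) * ln (F v) - ln (F x) =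
      l * (ln (F u) - ln (F x)) + (1 - l) * (ln (F v) - ln (F x))"
    by (simp add: algebra_simps)
  also have "\<dots> \<le> l * (real m * (ln (Y u) - ln (F x))) + (1 - l) * (real m * (ln (Y v) - ln (F x)))"
    using l slope pos by (intro add_mono mult_left_mono) auto
  also have "\<dots> = real m * (l * ln (Y u) + (1 - l) * ln (Y v) - ln (F x))"
    by (simp add: algebra_simps)
  also have "\<dots> \<le> 0" using Y by (simp add: mult_nonneg_nonpos)
  finally have "ln (F u powr l * F v powr (1 - l)) \<le> ln (F x)"
    using F_pos[of u] F_pos[of v] pos by (simp add: ln_mult_pos)
  then show ?thesis
    using F_pos[of u] F_pos[of v] F_pos[OF x] pos by (simp add: x_def[abs_def])
qed

text \<open>All directions, those in \<open>vs\<close> included, are shifted by \<open>e > 0\<close>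
  to become positive, and \<open>e\<close> tends to 0 from the right.\<close>

lemma mixed_log_concave:
  assumes C: "C (length vs + m) f"
    and nonneg: "set vs \<subseteq> nonneg_orthant V" "u \<in> nonneg_orthant V" "v \<in> nonneg_orthant V"
    and l: "0 \<le> l" "l \<le> 1"
  defines "F \<equiv> \<lambda>w. Poly_Mapping.lookup (dir_derivs V (replicate m w @ vs) f) 0"
  shows "0 \<le> F u" "F u powr l * F v powr (1 - l) \<le> F (\<lambda>i. l * u i + (1 - l) * v i)"
proof -
  define s where "s e w i = w i + e" for e :: real and w :: "'v \<Rightarrow> real" and i
  define G where "G e w =
    Poly_Mapping.lookup (dir_derivs V (map (s e) (replicate m w @ vs)) f) 0" for e w
  have G_tendsto: "((\<lambda>e. G e w) \<longlongrightarrow> F w) (at_right 0)" for w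
  proof -
    have "continuous_on UNIV (\<lambda>e. G e w)"
      unfolding G_def s_def[abs_def] by (rule continuous_mixed_shift)
    then have "((\<lambda>e. G e w) \<longlongrightarrow> G 0 w) (at_right 0)"
      unfolding continuous_on_def by (meson UNIV_I subset_UNIV tendsto_within_subset)
    moreover have "s 0 = (\<lambda>w. w)" by (simp add: s_def fun_eq_iff)
    ultimately show ?thesis by (simp add: G_def F_def)
  qed
  have s_pos: "positive (s e w)" if "e > 0" "w \<in> nonneg_orthant V" for e w
    using that by (auto simp: positive_def s_def nonneg_orthant_def intro: add_nonneg_pos)
  have G_nonneg: "0 \<le> G e w" if "e > 0" "w \<in> nonneg_orthant V" for e w
    unfolding G_def
    by (rule less_imp_le, rule mixed_pos)
       (use that C nonneg in \<open>auto simp: s_pos subset_iff add.commute\<close>)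
  have ev: "\<forall>\<^sub>F e in at_right 0. e > (0::real)" by (rule eventually_at_right_less)
  have F_nonneg: "0 \<le> F w" if "w \<in> nonneg_orthant V" for w
    using G_tendsto by (rule tendsto_lowerbound)
      (use ev that in \<open>auto elim!: eventually_mono intro: G_nonneg\<close>)
  then show "0 \<le> F u" using nonneg by blast
  show "F u powr l * F v powr (1 - l) \<le> F (\<lambda>i. l * u i + (1 - l) * v i)"
  \<comment> \<open>The limit of \<open>powr\<close> is taken at nonzero bases. At a zero base the
    left-hand side is 0, also for exponent 0.\<close>
  proof (cases "F u = 0 \<or> F v = 0")
    case True
    have "(\<lambda>i. l * u i + (1 - l) * v i) \<in> nonneg_orthant V"
      using nonneg l by (auto simp: nonneg_orthant_def)
    then show ?thesis using True F_nonneg by auto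
  next
    case False
    show ?thesis
    proof (rule tendsto_le[OF _ G_tendsto tendsto_mult[OF
          tendsto_powr[OF G_tendsto tendsto_const] tendsto_powr[OF G_tendsto tendsto_const]]])
      show "\<forall>\<^sub>F e in at_right 0. G e u powr l * G e v powr (1 - l) \<le> G e (\<lambda>i. l * u i + (1 - l) * v i)"
        using ev
      proof (rule eventually_mono)
        fix e :: real assume "e > 0"
        \<comment> \<open>The shift commutes with convex combinations because the weights add up to
          1.\<close>
        have "s e (\<lambda>i. l * u i + (1 - l) * v i) = (\<lambda>i. l * s e u i + (1 - l) * s e v i)"
          by (simp add: s_def fun_eq_iff algebra_simps)
        then show "G e u powr l * G e v powr (1 - l) \<le> G e (\<lambda>i. l * u i + (1 - l) * v i)"
          using mixed_log_concave_pos[of "map (s e) vs" m f "s e u" "s e v" l] C nonneg l \<open>e > 0\<close>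
          by (auto simp: G_def s_pos subset_iff)
      qed
    qed (use False in auto)
  qed
qed

theorem class_completely_log_concave:
  assumes "C d f"
  shows "completely_log_concave V f"
  unfolding completely_log_concave_def
proof (intro conjI allI impI)
  show "vars f \<subseteq> V" using assms by (rule class_vars)
  fix vs assume vs: "set vs \<subseteq> nonneg_orthant V"
  show "log_concave V (dir_derivs V vs f)"
  \<comment> \<open>With more derivatives than the degree, the result is the zero polynomial;
    otherwise it is homogeneous of degree \<open>m\<close>, and its values are mixed derivatives
    divided by \<open>fact m\<close>.\<close>
  proof (cases "d < length vs")
    case True
    then show ?thesis
      using class_homogeneous[OF assms] by (simp add: dir_derivs_eq_0 log_concave_def)
  next
    case False
    then obtain m where d: "d = length vs + m" by (metis le_Suc_ex not_le)
    let ?F = "\<lambda>w. Poly_Mapping.lookup (dir_derivs V (replicate m w @ vs) f) 0"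
    have eval: "evalp (dir_derivs V vs f) w = ?F w / fact m" for w
    proof -
      have "fact m * evalp (dir_derivs V vs f) w = ?F w"
        using class_vars[OF assms] vars_dir_derivs[of V vs f] class_homogeneous[OF assms]
        by (subst evalp_homogeneous[OF finite_V]) (auto simp: d intro!: homogeneous_dir_derivs)
      then show ?thesis by (simp add: field_simps)
    qed
    \<comment> \<open>The exponents add up to 1, so the factor \<open>fact m\<close> distributes
      over the two powers.\<close>
    have split: "?F u powr l * ?F v powr (1 - l) / fact m =
        (?F u / fact m) powr l * (?F v / fact m) powr (1 - l)"
      if "0 \<le> ?F u" "0 \<le> ?F v" for u v l
      using that by (simp add: powr_divide powr_diff)
    show ?thesis
      unfolding log_concave_def eval
    proof (intro conjI ballI)
      fix u assume u: "u \<in> nonneg_orthant V"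
      then show "0 \<le> ?F u / fact m"
        using mixed_log_concave(1)[of vs m f u u 0] assms vs by (simp add: d)
      fix v and l :: real assume "v \<in> nonneg_orthant V" "l \<in> {0..1}"
      then show "(?F u / fact m) powr l * (?F v / fact m) powr (1 - l)
          \<le> ?F (\<lambda>i. l * u i + (1 - l) * v i) / fact m"
        using mixed_log_concave[of vs m f u v l] mixed_log_concave(1)[of vs m f v v 0] assms vs u
        by (subst split[symmetric]) (auto simp: d divide_right_mono)
    qed
  qed
qed

end

subsection \<open>Matroids\<close>

text \<open>The double sum is the sum of the squares of the fibre sums. Cauchy--Schwarz over the
  fibres applies, and there are at most \<open>card A\<close> of them.\<close>

lemma sum_squared_le_card_fibres:
  fixes x :: "'a \<Rightarrow> real"
  assumes "finite A"
  shows "(\<Sum>i\<in>A. x i)\<^sup>2 \<le> real (card A) * (\<Sum>i\<in>A. \<Sum>j\<in>A. if f i = f j then x i * x j else 0)"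
proof -
  define s where "s c = (\<Sum>i\<in>{i\<in>A. f i = c}. x i)" for c
  have "(\<Sum>i\<in>A. \<Sum>j\<in>A. if f i = f j then x i * x j else 0) = (\<Sum>i\<in>A. x i * s (f i))"
  proof (intro sum.cong refl)
    fix i
    have "(\<Sum>j\<in>A. if f i = f j then x i * x j else 0) = (\<Sum>j\<in>{j\<in>A. f j = f i}. x i * x j)"
      unfolding sum.inter_filter[OF assms] by (intro sum.cong) auto
    then show "(\<Sum>j\<in>A. if f i = f j then x i * x j else 0) = x i * s (f i)"
      by (simp add: s_def sum_distrib_left)
  qed
  also have "\<dots> = (\<Sum>c\<in>f ` A. \<Sum>i\<in>{i\<in>A. f i = c}. x i * s (f i))"
    by (rule sum.image_gen[OF assms])
  also have "\<dots> = (\<Sum>c\<in>f ` A. (s c)\<^sup>2)"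
    by (intro sum.cong refl) (simp add: s_def power2_eq_square flip: sum_distrib_right)
  finally have eq: "(\<Sum>i\<in>A. \<Sum>j\<in>A. if f i = f j then x i * x j else 0) = (\<Sum>c\<in>f ` A. (s c)\<^sup>2)" .
  have "(\<Sum>i\<in>A. x i) = (\<Sum>c\<in>f ` A. s c)"
    unfolding s_def by (rule sum.image_gen[OF assms])
  then have "(\<Sum>i\<in>A. x i)\<^sup>2 \<le> real (card (f ` A)) * (\<Sum>c\<in>f ` A. (s c)\<^sup>2)"
    using Cauchy_Schwarz_ineq_sum[of "\<lambda>_. 1" s "f ` A"] by simp
  also have "\<dots> \<le> real (card A) * (\<Sum>c\<in>f ` A. (s c)\<^sup>2)"
    by (intro mult_right_mono sum_nonneg) (use card_image_le[OF assms] in auto)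
  finally show ?thesis by (simp only: eq)
qed

text \<open>When \<open>{j}\<close> is independent in a matroid, these are the independent sets of
  its contraction by \<open>j\<close>. The ground set is kept, with \<open>j\<close> as a
  loop.\<close>

definition link :: "'a \<Rightarrow> 'a set set \<Rightarrow> 'a set set" where
  "link j \<I> = {I. j \<notin> I \<and> insert j I \<in> \<I>}"

lemma matroid_empty: "matroid n \<I> \<Longrightarrow> {} \<in> \<I>"
  unfolding matroid_def by (metis empty_subsetI equals0I)

lemma matroid_subset: "matroid n \<I> \<Longrightarrow> I \<in> \<I> \<Longrightarrow> I \<subseteq> {1..n}"
  by (auto simp: matroid_def)

lemma matroid_finite: "matroid n \<I> \<Longrightarrow> finite \<I>"
  unfolding matroid_def by (meson finite_Pow_iff finite_atLeastAtMost finite_subset)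

lemma matroid_finite_indep: "matroid n \<I> \<Longrightarrow> I \<in> \<I> \<Longrightarrow> finite I"
  by (rule finite_subset[OF matroid_subset]) auto

lemma matroid_hereditary: "matroid n \<I> \<Longrightarrow> T \<in> \<I> \<Longrightarrow> S \<subseteq> T \<Longrightarrow> S \<in> \<I>"
  unfolding matroid_def by metis

lemma matroid_exchange:
  assumes "matroid n \<I>" "S \<in> \<I>" "T \<in> \<I>" "card S < card T"
  obtains i where "i \<in> T - S" "insert i S \<in> \<I>"
  using assms unfolding matroid_def by (metis Un_insert_right sup_bot.right_neutral)

text \<open>Inserting \<open>j\<close> raises both cardinalities by one, and exchange between the
  enlarged sets returns an element other than \<open>j\<close>.\<close>

lemma matroid_link:
  assumes M: "matroid n \<I>" and j: "{j} \<in> \<I>"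
  shows "matroid n (link j \<I>)"
  unfolding matroid_def
proof (intro conjI allI impI ballI)
  show "link j \<I> \<subseteq> Pow {1..n}"
    using matroid_subset[OF M] by (fastforce simp: link_def)
  show "link j \<I> \<noteq> {}" using j by (auto simp: link_def)
  show "S \<in> link j \<I>" if "S \<subseteq> T \<and> T \<in> link j \<I>" for S T
    using that matroid_hereditary[OF M, of "insert j T" "insert j S"] by (auto simp: link_def)
  fix S T assume S: "S \<in> link j \<I>" and T: "T \<in> link j \<I>" and less: "card S < card T"
  have ST: "insert j S \<in> \<I>" "insert j T \<in> \<I>" using S T by (auto simp: link_def)
  then have fin: "finite S" "finite T"
    using matroid_finite_indep[OF M] by (metis finite_insert)+
  then have "card (insert j S) < card (insert j T)"
    using S T less by (simp add: link_def)
  then obtain i where "i \<in> insert j T - insert j S" "insert i (insert j S) \<in> \<I>"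
    by (rule matroid_exchange[OF M ST])
  then show "\<exists>i\<in>T - S. S \<union> {i} \<in> link j \<I>"
    using S by (intro bexI[of _ i]) (auto simp: link_def insert_commute)
qed

text \<open>If \<open>{i, k}\<close> were an independent pair, exchange would extend
  \<open>{j}\<close> by \<open>i\<close> or by \<open>k\<close>, against one of the two
  parallelisms.\<close>

lemma matroid_parallel_trans:
  assumes M: "matroid n \<I>" and "{j} \<in> \<I>" "i = j \<or> {i, j} \<notin> \<I>" "j = k \<or> {j, k} \<notin> \<I>"
  shows "i = k \<or> {i, k} \<notin> \<I>"
proof (rule ccontr)
  assume "\<not> (i = k \<or> {i, k} \<notin> \<I>)"
  then have "{i, k} \<in> \<I>" "card {j} < card {i, k}" by auto
  then obtain l where "l \<in> {i, k} - {j}" "{l, j} \<in> \<I>"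
    using matroid_exchange[OF M \<open>{j} \<in> \<I>\<close>] by metis
  then show False
    using assms(3,4) \<open>{i, k} \<in> \<I>\<close> by (auto simp: insert_commute)
qed

section \<open>Independence polynomials and their derivatives\<close>

definition indep_monom :: "nat set \<Rightarrow> nat \<Rightarrow> nat \<Rightarrow>\<^sub>0 nat" where
  "indep_monom I d = Poly_Mapping.single 0 (d - card I) + (\<Sum>i\<in>I. Poly_Mapping.single i 1)"

lemma lookup_indep_monom:
  assumes "finite I" "0 \<notin> I"
  shows "Poly_Mapping.lookup (indep_monom I d) i =
    (if i = 0 then d - card I else if i \<in> I then 1 else 0)"
  using assms by (auto simp: indep_monom_def lookup_add lookup_sum lookup_single when_def)

text \<open>The derivative of order \<open>N - d\<close> in \<open>y\<close> of \<open>g\<^sub>M\<close> with \<open>N\<close> in place of \<open>n\<close>.\<close>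

definition indep_poly :: "nat set set \<Rightarrow> nat \<Rightarrow> nat \<Rightarrow> nat real_mpoly" where
  "indep_poly \<I> N d = (\<Sum>I\<in>{I\<in>\<I>. card I \<le> d}.
     Poly_Mapping.single (indep_monom I d) (fact (N - card I) / fact (d - card I)))"

lemma indep_poly_empty [simp]: "indep_poly {} N d = 0"
  by (simp add: indep_poly_def)

lemma keys_indep_poly:
  assumes "m \<in> Poly_Mapping.keys (indep_poly \<I> N d)"
  obtains I where "I \<in> \<I>" "card I \<le> d" "m = indep_monom I d"
proof -
  have "Poly_Mapping.keys (indep_poly \<I> N d) \<subseteq>
    (\<Union>I\<in>{I\<in>\<I>. card I \<le> d}. Poly_Mapping.keys
      (Poly_Mapping.single (indep_monom I d) (fact (N - card I) / fact (d - card I) :: real)))"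
    unfolding indep_poly_def by (rule keys_sum)
  with assms show thesis by (auto intro: that split: if_splits)
qed

context
  fixes n :: nat and \<I> :: "nat set set"
  assumes M: "matroid n \<I>"
begin

lemma zero_notin_indep: "I \<in> \<I> \<Longrightarrow> 0 \<notin> I"
  using matroid_subset[OF M] by fastforce

lemmas lookup_indep = lookup_indep_monom[OF matroid_finite_indep[OF M] zero_notin_indep]

lemma vars_indep_poly: "vars (indep_poly \<I> N d) \<subseteq> {0..n}"
proof
  fix i assume "i \<in> vars (indep_poly \<I> N d)"
  then obtain m where "m \<in> Poly_Mapping.keys (indep_poly \<I> N d)" "i \<in> Poly_Mapping.keys m"
    by (auto simp: vars_def)
  then show "i \<in> {0..n}"
    by (elim keys_indep_poly)
       (use matroid_subset[OF M] in \<open>force simp: in_keys_iff lookup_indep split: if_splits\<close>)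
qed

lemma homogeneous_indep_poly: "homogeneous d (indep_poly \<I> N d)"
  unfolding homogeneous_def
proof
  fix m assume m: "m \<in> Poly_Mapping.keys (indep_poly \<I> N d)"
  then obtain I where I: "I \<in> \<I>" "card I \<le> d" "m = indep_monom I d" by (rule keys_indep_poly)
  have "(\<Sum>i\<in>Poly_Mapping.keys m. Poly_Mapping.lookup m i) =
      (\<Sum>i\<in>insert 0 I. Poly_Mapping.lookup m i)"
    by (rule sum.mono_neutral_left)
       (use I matroid_finite_indep[OF M] in \<open>auto simp: in_keys_iff lookup_indep split: if_splits\<close>)
  also have "\<dots> = (d - card I) + (\<Sum>i\<in>I. Poly_Mapping.lookup m i)"
    using I matroid_finite_indep[OF M] zero_notin_indep
    by (subst sum.insert) (simp_all add: lookup_indep)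
  also have "\<dots> = (d - card I) + (\<Sum>i\<in>I. 1)"
    by (intro arg_cong2[where f = "(+)"] sum.cong refl)
       (use I zero_notin_indep in \<open>auto simp: lookup_indep\<close>)
  also have "\<dots> = d" using I by simp
  finally show "(\<Sum>i\<in>Poly_Mapping.keys m. Poly_Mapping.lookup m i) = d" .
qed

lemma lookup_indep_poly_0: "Poly_Mapping.lookup (indep_poly \<I> N 0) 0 = fact N"
proof -
  have "{I\<in>\<I>. card I \<le> 0} = {{}}"
    using matroid_empty[OF M] matroid_finite_indep[OF M] by auto
  then show ?thesis by (simp add: indep_poly_def indep_monom_def)
qed

text \<open>The exponent of \<open>y\<close> cancels one factor of the factorial in the denominator;
  sets of size \<open>Suc d\<close> carry no \<open>y\<close> and disappear.\<close>

lemma partial_deriv_0_indep_poly: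
  "partial_deriv 0 (indep_poly \<I> N (Suc d)) = indep_poly \<I> N d"
proof -
  have "partial_deriv 0 (indep_poly \<I> N (Suc d)) =
    (\<Sum>I\<in>{I\<in>\<I>. card I \<le> Suc d}. Poly_Mapping.single (indep_monom I (Suc d) - Poly_Mapping.single 0 1)
      (real (Suc d - card I) * (fact (N - card I) / fact (Suc d - card I))))"
    unfolding indep_poly_def partial_deriv_sum partial_deriv_single
    by (intro sum.cong refl) (simp add: lookup_indep)
  also have "\<dots> = (\<Sum>I\<in>{I\<in>\<I>. card I \<le> d}. Poly_Mapping.single (indep_monom I (Suc d) - Poly_Mapping.single 0 1)
      (real (Suc d - card I) * (fact (N - card I) / fact (Suc d - card I))))"
  proof (rule sum.mono_neutral_right)
    show "\<forall>I\<in>{I\<in>\<I>. card I \<le> Suc d} - {I\<in>\<I>. card I \<le> d}.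
      Poly_Mapping.single (indep_monom I (Suc d) - Poly_Mapping.single 0 1)
        (real (Suc d - card I) * (fact (N - card I) / fact (Suc d - card I))) = 0"
    proof
      fix I assume "I \<in> {I\<in>\<I>. card I \<le> Suc d} - {I\<in>\<I>. card I \<le> d}"
      then have "Suc d - card I = 0" by auto
      then show "Poly_Mapping.single (indep_monom I (Suc d) - Poly_Mapping.single 0 1)
        (real (Suc d - card I) * (fact (N - card I) / fact (Suc d - card I))) = 0"
        by (simp only: of_nat_0 mult_zero_left single_zero)
    qed
  qed (auto simp: matroid_finite[OF M])
  also have "\<dots> = indep_poly \<I> N d"
    unfolding indep_poly_def
  proof (intro sum.cong refl)
    fix I assume "I \<in> {I\<in>\<I>. card I \<le> d}"
    then have I: "I \<in> \<I>" "card I \<le> d" by auto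
    have "indep_monom I (Suc d) - Poly_Mapping.single 0 1 = indep_monom I d"
      using I by (intro poly_mapping_eqI)
        (simp add: lookup_minus lookup_indep lookup_single when_def)
    moreover have "real (Suc d - card I) * (fact (N - card I) / fact (Suc d - card I)) =
      fact (N - card I) / fact (d - card I)"
      using I by (simp add: Suc_diff_le del: of_nat_Suc)
    ultimately show "Poly_Mapping.single (indep_monom I (Suc d) - Poly_Mapping.single 0 1)
      (real (Suc d - card I) * (fact (N - card I) / fact (Suc d - card I))) =
      Poly_Mapping.single (indep_monom I d) (fact (N - card I) / fact (d - card I))"
      by simp
  qed
  finally show ?thesis .
qed

text \<open>Only the sets containing \<open>j\<close> survive. Removing \<open>j\<close> lowers the
  cardinality by one, so lowering \<open>N\<close> and the degree by one keeps the
  coefficients.\<close>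

lemma partial_deriv_indep_poly:
  assumes "j \<noteq> 0"
  shows "partial_deriv j (indep_poly \<I> N (Suc d)) = indep_poly (link j \<I>) (N - 1) d"
proof -
  let ?t = "\<lambda>I. Poly_Mapping.single (indep_monom I (Suc d) - Poly_Mapping.single j 1)
      (if j \<in> I then fact (N - card I) / fact (Suc d - card I) else 0 :: real)"
  have "partial_deriv j (indep_poly \<I> N (Suc d)) =
      (\<Sum>I\<in>{I\<in>\<I>. card I \<le> Suc d}. ?t I)"
    unfolding indep_poly_def partial_deriv_sum partial_deriv_single
    using assms by (intro sum.cong refl) (simp add: lookup_indep)
  also have "\<dots> = (\<Sum>I\<in>{I\<in>\<I>. card I \<le> Suc d \<and> j \<in> I}. ?t I)"
    by (rule sum.mono_neutral_right) (auto simp: matroid_finite[OF M])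
  also have "\<dots> = indep_poly (link j \<I>) (N - 1) d"
    unfolding indep_poly_def
  proof (rule sum.reindex_bij_witness[where i = "insert j" and j = "\<lambda>I. I - {j}"], goal_cases)
    case (1 I) then show ?case by auto
  next
    case (2 I) then show ?case using matroid_finite_indep[OF M] by (auto simp: link_def insert_absorb)
  next
    case (3 I) then show ?case by (auto simp: link_def)
  next
    case (4 I)
    then have "finite (insert j I)" using matroid_finite_indep[OF M, of "insert j I"] by (simp add: link_def)
    then show ?case using 4 by (auto simp: link_def)
  next
    case (5 I)
    then have I: "I \<in> \<I>" "j \<in> I" "finite I" using matroid_finite_indep[OF M] by auto
    have "I - {j} \<in> \<I>" using matroid_hereditary[OF M I(1)] by blast
    moreover have card: "card I = Suc (card (I - {j}))" using I by (metis card.remove)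
    ultimately have "indep_monom (I - {j}) d = indep_monom I (Suc d) - Poly_Mapping.single j 1"
      using assms I
      by (intro poly_mapping_eqI) (simp add: lookup_minus lookup_indep lookup_single when_def)
    then show ?case using I card by simp
  qed
  finally show ?thesis .
qed

end

lemma link_empty: "matroid n \<I> \<Longrightarrow> {j} \<notin> \<I> \<Longrightarrow> link j \<I> = {}"
  using matroid_hereditary[of n \<I> _ "{j}"] by (auto simp: link_def)

lemma lookup_indep_poly_link:
  assumes "matroid n \<I>"
  shows "Poly_Mapping.lookup (indep_poly (link j \<I>) N 0) 0 = (if {j} \<in> \<I> then fact N else 0)"
  using lookup_indep_poly_0[OF matroid_link[OF assms]] link_empty[OF assms] by auto

lemma lookup_indep_poly_link2:
  assumes "matroid n \<I>"
  shows "Poly_Mapping.lookup (indep_poly (link i (link j \<I>)) N 0) 0 =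
    (if i \<noteq> j \<and> {i, j} \<in> \<I> then fact N else 0)"
proof (cases "{j} \<in> \<I>")
  case True
  then show ?thesis
    using lookup_indep_poly_link[OF matroid_link[OF assms True]] by (auto simp: link_def insert_commute)
next
  case False
  then have "{i, j} \<notin> \<I>" using matroid_hereditary[OF assms, of "{i, j}" "{j}"] by auto
  moreover have "link i (link j \<I>) = {}"
    unfolding link_empty[OF assms False] by (simp add: link_def)
  ultimately show ?thesis by simp
qed

text \<open>On the hyperplane \<open>N * x 0 + \<sigma> x = 0\<close> the form is
  \<open>fact (N - 2)\<close> times \<open>N * (x 0)\<^sup>2 - q x\<close>. It is nonpositive by
  Cauchy--Schwarz over the parallel classes.\<close>

lemma indep_poly_2_lorentzian:
  assumes M: "matroid n \<I>" and N: "card (\<Union>\<I>) \<le> N" "2 \<le> N"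
  shows "lorentzian {0..n} (indep_poly \<I> N 2)"
proof -
  \<comment> \<open>The elements that are not loops; on them \<open>par\<close> is an equivalence
    relation.\<close>
  define E where "E = \<Union>\<I>"
  define f where "f = indep_poly \<I> N 2"
  define par where "par i j \<longleftrightarrow> i = j \<or> {i, j} \<notin> \<I>" for i j
  define q where "q x = (\<Sum>i\<in>E. \<Sum>j\<in>E. if par i j then x i * x j else 0)" for x :: "nat \<Rightarrow> real"
  define \<sigma> where "\<sigma> x = (\<Sum>i\<in>E. x i)" for x :: "nat \<Rightarrow> real"
  have E: "E \<subseteq> {1..n}" using matroid_subset[OF M] by (auto simp: E_def)
  then have fin: "finite E" using finite_subset by blast
  have mem_E: "j \<in> E \<longleftrightarrow> {j} \<in> \<I>" for j
    using matroid_hereditary[OF M, of _ "{j}"] by (auto simp: E_def)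
  have pair_E: "i \<in> E" "j \<in> E" if "{i, j} \<in> \<I>" for i j
    using that by (auto simp: E_def)
  obtain K where K: "N = K + 2" using N(2) by (metis add.commute le_Suc_ex)
  have f: "f = indep_poly \<I> N (Suc (Suc 0))" by (simp add: f_def numeral_2_eq_2)
  define c where "c i j = Poly_Mapping.lookup (partial_deriv i (partial_deriv j f)) 0" for i j
  have c00: "c 0 0 = fact N"
    by (simp add: c_def f partial_deriv_0_indep_poly[OF M] lookup_indep_poly_0[OF M])
  have ci0: "c i 0 = (if i \<in> E then fact (N - 1) else 0)" if "i \<in> {1..n}" for i
    using that
    by (simp add: c_def f partial_deriv_0_indep_poly[OF M] partial_deriv_indep_poly[OF M]
        lookup_indep_poly_link[OF M] mem_E)
  have c0i: "c 0 i = c i 0" for i by (simp add: c_def partial_deriv_commute)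
  have cij: "c i j = (if i \<in> E \<and> j \<in> E \<and> \<not> par i j then fact (N - 2) else 0)"
    if "i \<in> {1..n}" "j \<in> {1..n}" for i j
  proof (cases "{j} \<in> \<I>")
    case True
    have "c i j = (if i \<noteq> j \<and> {i, j} \<in> \<I> then fact (N - 2) else 0)"
      using that
      by (simp add: c_def f partial_deriv_indep_poly[OF M] partial_deriv_indep_poly[OF matroid_link[OF M True]]
          lookup_indep_poly_link2[OF M] numeral_2_eq_2)
    then show ?thesis using pair_E[of i j] by (auto simp: par_def)
  next
    case False
    then show ?thesis
      using that by (simp add: c_def f partial_deriv_indep_poly[OF M] link_empty[OF M] mem_E)
  qed
  have split0: "(\<Sum>i\<in>{0..n}. g i) = g 0 + (\<Sum>i\<in>{1..n}. g i)" for g :: "nat \<Rightarrow> real"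
    by (simp add: sum.atLeast_Suc_atMost)
  have sum_E: "(\<Sum>i\<in>{1..n}. g i) = (\<Sum>i\<in>E. g i)"
    if "\<And>i. i \<in> {1..n} \<Longrightarrow> i \<notin> E \<Longrightarrow> g i = 0" for g :: "nat \<Rightarrow> real"
    by (rule sum.mono_neutral_right) (use E that in auto)
  have polar: "polar {0..n} f x x =
      fact N * (x 0)\<^sup>2 + 2 * fact (N - 1) * x 0 * \<sigma> x + fact (N - 2) * ((\<sigma> x)\<^sup>2 - q x)" for x
  proof -
    have row0: "(\<Sum>j\<in>{1..n}. x 0 * x j * c 0 j) = fact (N - 1) * x 0 * \<sigma> x"
    proof -
      have "(\<Sum>j\<in>{1..n}. x 0 * x j * c 0 j) = (\<Sum>j\<in>E. x 0 * x j * c 0 j)"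
        by (rule sum_E) (simp add: c0i ci0)
      also have "\<dots> = (\<Sum>j\<in>E. fact (N - 1) * x 0 * x j)"
        by (intro sum.cong refl) (use E in \<open>auto simp: c0i ci0 subset_iff\<close>)
      finally show ?thesis by (simp only: \<sigma>_def sum_distrib_left)
    qed
    have "polar {0..n} f x x = (x 0)\<^sup>2 * c 0 0 + (\<Sum>j\<in>{1..n}. x 0 * x j * c 0 j)
      + ((\<Sum>i\<in>{1..n}. x i * x 0 * c i 0) + (\<Sum>i\<in>{1..n}. \<Sum>j\<in>{1..n}. x i * x j * c i j))"
      unfolding polar_sum split0 c_def[symmetric] by (simp add: sum.distrib power2_eq_square)
    also note row0
    also have "(\<Sum>i\<in>{1..n}. x i * x 0 * c i 0) = fact (N - 1) * x 0 * \<sigma> x"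
      using row0 by (simp add: c0i mult.commute)
    also have "(\<Sum>i\<in>{1..n}. \<Sum>j\<in>{1..n}. x i * x j * c i j) = (\<Sum>i\<in>E. \<Sum>j\<in>{1..n}. x i * x j * c i j)"
      by (rule sum_E) (simp add: cij)
    also have "\<dots> = (\<Sum>i\<in>E. \<Sum>j\<in>E. x i * x j * c i j)"
      by (intro sum.cong refl sum_E) (use E in \<open>auto simp: cij subset_iff\<close>)
    also have "\<dots> = (\<Sum>i\<in>E. \<Sum>j\<in>E. fact (N - 2) * (x i * x j - (if par i j then x i * x j else 0)))"
      by (intro sum.cong refl) (use E in \<open>auto simp: cij subset_iff\<close>)
    also have "\<dots> = fact (N - 2) * ((\<sigma> x)\<^sup>2 - q x)"
      unfolding q_def \<sigma>_def power2_eq_square sum_product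
      by (simp add: sum_subtractf flip: sum_distrib_left)
    finally show ?thesis by (simp add: c00)
  qed
  have par_sym: "par i j \<longleftrightarrow> par j i" for i j by (auto simp: par_def insert_commute)
  have par_trans: "par i k" if "par i j" "par j k" "j \<in> E" for i j k
    using matroid_parallel_trans[OF M, of j i k] that by (auto simp: par_def mem_E)
  \<comment> \<open>Sending an element to its parallel class makes the classes the fibres of a
    function, as \<open>sum_squared_le_card_fibres\<close> requires.\<close>
  have par_class: "par i j \<longleftrightarrow> {k\<in>E. par i k} = {k\<in>E. par j k}" if "i \<in> E" "j \<in> E" for i j
  proof
    assume "par i j"
    then show "{k\<in>E. par i k} = {k\<in>E. par j k}"
      using that par_trans[of i j] par_trans[of j i] par_sym by blast
  next
    assume eq: "{k\<in>E. par i k} = {k\<in>E. par j k}"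
    have "j \<in> {k\<in>E. par j k}" using that by (simp add: par_def)
    then show "par i j" unfolding eq[symmetric] by simp
  qed
  have q: "(\<sigma> x)\<^sup>2 \<le> real N * q x" for x
  proof -
    have q_eq: "q x = (\<Sum>i\<in>E. \<Sum>j\<in>E. if {k\<in>E. par i k} = {k\<in>E. par j k} then x i * x j else 0)"
      unfolding q_def by (intro sum.cong refl) (simp add: par_class)
    have le: "(\<sigma> x)\<^sup>2 \<le> real (card E) * q x"
      unfolding q_eq \<sigma>_def by (rule sum_squared_le_card_fibres[OF fin])
    \<comment> \<open>For nonempty \<open>E\<close> this follows from \<open>le\<close> itself,
      whose left-hand side is a square. It permits replacing \<open>card E\<close> by the larger
      \<open>N\<close>.\<close>
    have "0 \<le> q x"
    proof (cases "card E = 0")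
      case True
      then show ?thesis using fin by (simp add: q_def)
    next
      case False
      have "0 \<le> real (card E) * q x" using le by (rule order_trans[rotated]) simp
      then show ?thesis using False by (simp add: zero_le_mult_iff)
    qed
    then have "real (card E) * q x \<le> real N * q x"
      using N(1) by (intro mult_right_mono) (auto simp: E_def)
    with le show ?thesis by simp
  qed
  show ?thesis
    unfolding f_def[symmetric]
  proof (rule lorentzianI[where L = "\<lambda>x. real N * x 0 + \<sigma> x"])
    fix x assume "real N * x 0 + \<sigma> x = 0"
    then have \<sigma>: "\<sigma> x = - real N * x 0" by simp
    have "polar {0..n} f x x = - fact K * (q x - real N * (x 0)\<^sup>2)"
      unfolding polar by (simp add: \<sigma> K fact_numeral algebra_simps power2_eq_square)
    moreover have "real N * (real N * (x 0)\<^sup>2) \<le> real N * q x"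
      using q[of x] by (simp add: \<sigma> power2_eq_square mult_ac)
    then have "real N * (x 0)\<^sup>2 \<le> q x" using N(2) by simp
    ultimately show "polar {0..n} f x x \<le> 0" by simp
  next
    fix x a t
    show "real N * (x 0 - t * a 0) + \<sigma> (\<lambda>i. x i - t * a i) =
      real N * x 0 + \<sigma> x - t * (real N * a 0 + \<sigma> a)"
      by (simp add: \<sigma>_def sum_subtractf sum_distrib_left algebra_simps)
  next
    fix a :: "nat \<Rightarrow> real" assume "\<And>i. i \<in> {0..n} \<Longrightarrow> 0 < a i"
    then have a: "0 < a i" if "i \<in> insert 0 E" for i using that E by (auto simp: subset_iff)
    have "0 \<le> \<sigma> a" unfolding \<sigma>_def using a by (intro sum_nonneg) (simp add: less_imp_le)
    then show "0 < real N * a 0 + \<sigma> a" using a N(2) by (intro add_pos_nonneg) auto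
    \<comment> \<open>The difference is the sum over the pairs that are not parallel, whose terms
      are positive.\<close>
    have "q a \<le> (\<sigma> a)\<^sup>2"
      unfolding q_def \<sigma>_def power2_eq_square sum_product
      using a by (intro sum_mono) (simp add: less_imp_le)
    then show "0 \<le> polar {0..n} f a a"
      unfolding polar using \<open>0 \<le> \<sigma> a\<close> a[of 0] by (intro add_nonneg_nonneg) auto
  qed
qed

text \<open>Differentiation in \<open>y\<close> lowers only \<open>d\<close>, while contraction
  lowers both \<open>d\<close> and \<open>N\<close>. The bound on the number of non-loops is what
  Cauchy--Schwarz uses for quadrics, and \<open>d \<le> N\<close> gives \<open>2 \<le> N\<close>
  there.\<close>

definition matroid_class :: "nat \<Rightarrow> nat \<Rightarrow> nat real_mpoly \<Rightarrow> bool" where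
  "matroid_class n d f \<longleftrightarrow>
    (\<exists>\<I> N. f = indep_poly \<I> N d \<and> matroid n \<I> \<and> card (\<Union>\<I>) \<le> N \<and> d \<le> N)"

lemma lorentzian_class_matroid: "lorentzian_class {0..n} 0 (matroid_class n)"
proof
  fix d f i assume "matroid_class n (Suc d) f" and i: "i \<in> {0..n}"
  then obtain \<I> N where f: "f = indep_poly \<I> N (Suc d)" and M: "matroid n \<I>"
    and N: "card (\<Union>\<I>) \<le> N" "Suc d \<le> N"
    by (auto simp: matroid_class_def)
  show "partial_deriv i f = 0 \<or> matroid_class n d (partial_deriv i f)"
  proof (cases "i = 0")
    case True
    then have "partial_deriv i f = indep_poly \<I> N d" by (simp add: f partial_deriv_0_indep_poly[OF M])
    then show ?thesis using M N unfolding matroid_class_def by (metis Suc_leD)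
  next
    case False
    then have eq: "partial_deriv i f = indep_poly (link i \<I>) (N - 1) d"
      by (simp add: f partial_deriv_indep_poly[OF M])
    show ?thesis
    proof (cases "{i} \<in> \<I>")
      case True
      have fin: "finite (\<Union>\<I>)" using matroid_finite[OF M] matroid_finite_indep[OF M] by blast
      \<comment> \<open>Contraction turns \<open>i\<close> into a loop and creates no new non-loops,
        so the bound survives with \<open>N - 1\<close>.\<close>
      have "\<Union>(link i \<I>) \<subseteq> \<Union>\<I> - {i}" by (auto simp: link_def)
      then have "card (\<Union>(link i \<I>)) \<le> card (\<Union>\<I> - {i})" by (rule card_mono[rotated]) (simp add: fin)
      also have "\<dots> \<le> N - 1" using True fin N by (subst card_Diff_singleton) auto
      finally show ?thesis
        using matroid_link[OF M True] N unfolding matroid_class_def eq by fastforce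
    next
      case False
      then show ?thesis using eq link_empty[OF M] by simp
    qed
  qed
next
  fix d f assume "matroid_class n (Suc d) f"
  then show "matroid_class n d (partial_deriv 0 f)"
    unfolding matroid_class_def using partial_deriv_0_indep_poly by (metis Suc_leD)
qed (auto simp: matroid_class_def homogeneous_indep_poly lookup_indep_poly_0 indep_poly_2_lorentzian
      dest: vars_indep_poly[THEN subsetD])

text \<open>For \<open>N = d = n\<close> the factorials cancel, and every independent set meets the
  size bound.\<close>

lemma matroid_poly_eq_indep_poly:
  assumes "matroid n \<I>"
  shows "matroid_poly n \<I> = indep_poly \<I> n n"
proof -
  have card: "card I \<le> n" if "I \<in> \<I>" for I
    using card_mono[OF _ matroid_subset[OF assms that]] by simp
  have pow: "var 0 ^ k = Poly_Mapping.single (Poly_Mapping.single 0 k) 1" for k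
    by (induction k) (simp_all add: var_def mult_single single_add[symmetric])
  have "(\<Prod>i\<in>I. var i) = Poly_Mapping.single (\<Sum>i\<in>I. Poly_Mapping.single i 1) 1"
    if "finite I" for I :: "nat set"
    using that by (induction I) (simp_all add: var_def mult_single)
  then have "matroid_poly n \<I> = (\<Sum>I\<in>\<I>. Poly_Mapping.single (indep_monom I n) 1)"
    unfolding matroid_poly_def indep_monom_def
    by (intro sum.cong refl) (simp add: pow mult_single matroid_finite_indep[OF assms])
  also have "\<dots> = indep_poly \<I> n n"
    unfolding indep_poly_def using card by (intro sum.cong) auto
  finally show ?thesis .
qed

theorem theorem4p1:
  fixes n :: nat and \<I> :: "nat set set"
  assumes "matroid n \<I>"
  shows "completely_log_concave {0..n} (matroid_poly n \<I>)"
proof -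
  interpret lorentzian_class "{0..n}" 0 "matroid_class n"
    by (rule lorentzian_class_matroid)
  have "\<Union>\<I> \<subseteq> {1..n}" using matroid_subset[OF assms] by blast
  then have "card (\<Union>\<I>) \<le> n" using card_mono[of "{1..n}"] by simp
  then have "matroid_class n n (matroid_poly n \<I>)"
    using assms by (auto simp: matroid_class_def matroid_poly_eq_indep_poly)
  then show ?thesis by (rule class_completely_log_concave)
qed

end
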